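(* For every $g>g_H := \frac{2\sqrt N}{(\alpha-1)\mu_{EE}}$, the system $$\dot{\mathbf x} = -\mathbf x+\frac{1}{\sqrt N}H\tanh(g\mathbf x),\qquad \mathbf x\in\mathbb R^N,$$ has a limit cycle in which all excitatory cells are synchronized and all inhibitory cells are synchronized, i.e. a limit cycle $\mathbf x(t)$ with $x_1(t)=\dots=x_{n_E}(t)$ and $x_{n_E+1}(t)=\dots=x_N(t)$ for all $t$.
   Context: Let $n_E,n_I\ge1$ be integers, $N=n_E+n_I$, $f=n_E/N$, $\alpha=\frac{f}{1-f}$ (so $n_E=\alpha n_I$), with $\alpha>1$, and let $\mu_{EE}>0$. The function $\tanh$ acts on vectors componentwise. $\mathbf 1_{m\times n}$ is the $m\times n$ all-ones matrix and $\mathbf K_n=\mathbf 1_{n\times n}-\mathbf I_n$, where $\mathbf I_n$ is the identity. The $N\times N$ connectivity matrix (all-to-all network without self-coupling, balanced weights) is $$H=\begin{bmatrix}\mu_{EE}\mathbf K_{n_E} & -\alpha\mu_{EE}\mathbf 1_{n_E\times n_I}\\ \mu_{EE}\mathbf 1_{n_I\times n_E} & -\alpha\mu_{EE}\mathbf K_{n_I}\end{bmatrix}.$$ The first $n_E$ coordinates are the excitatory cells, the last $n_I$ the inhibitory cells. A limit cycle is a nonconstant periodic orbit that is the $\alpha$- or $\omega$-limit set of some trajectory not lying on it. *)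

theory Defs
  imports "HOL-Analysis.Analysis"
begin

definition is_trajectory :: "(real^'n \<Rightarrow> real^'n) \<Rightarrow> (real \<Rightarrow> real^'n) \<Rightarrow> bool"
  where "is_trajectory F x \<longleftrightarrow> (\<forall>t. (x has_vector_derivative F (x t)) (at t))"

definition omega_limit_set :: "(real \<Rightarrow> 'a::topological_space) \<Rightarrow> 'a set"
  where "omega_limit_set x =
    {p. \<exists>s::nat \<Rightarrow> real. filterlim s at_top sequentially \<and> (\<lambda>n. x (s n)) \<longlonglongrightarrow> p}"

definition alpha_limit_set :: "(real \<Rightarrow> 'a::topological_space) \<Rightarrow> 'a set"
  where "alpha_limit_set x =
    {p. \<exists>s::nat \<Rightarrow> real. filterlim s at_bot sequentially \<and> (\<lambda>n. x (s n)) \<longlonglongrightarrow> p}"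

(* Trajectories are defined for all real times. For globally Lipschitz F, such as the network
   vector field below, every maximal solution is of this kind. *)
definition is_limit_cycle :: "(real^'n \<Rightarrow> real^'n) \<Rightarrow> (real \<Rightarrow> real^'n) \<Rightarrow> bool"
  where "is_limit_cycle F x \<longleftrightarrow>
    is_trajectory F x \<and>
    (\<exists>s t. x s \<noteq> x t) \<and>
    (\<exists>T>0. \<forall>t. x (t + T) = x t) \<and>
    (\<exists>y. is_trajectory F y \<and> \<not> range y \<subseteq> range x \<and>
         (omega_limit_set y = range x \<or> alpha_limit_set y = range x))"

(* real^'n^'m is the type of matrices with rows indexed by 'm and columns by 'n. *)
definition ones_mat :: "real^'n^'m"
  where "ones_mat = (\<chi> i j. 1)"

definition K_mat :: "real^'n^'n"
  where "K_mat = ones_mat - mat 1"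

definition block_mat ::
    "real^'e^'e \<Rightarrow> real^'i^'e \<Rightarrow> real^'e^'i \<Rightarrow> real^'i^'i \<Rightarrow> real^('e::finite + 'i::finite)^('e + 'i)"
  where "block_mat A B C D = (\<chi> i j.
    (case i of
       Inl a \<Rightarrow> (case j of Inl b \<Rightarrow> A $ a $ b | Inr b \<Rightarrow> B $ a $ b)
     | Inr a \<Rightarrow> (case j of Inl b \<Rightarrow> C $ a $ b | Inr b \<Rightarrow> D $ a $ b)))"

(* Coordinates Inl are the excitatory cells, coordinates Inr the inhibitory cells. *)
definition H_mat :: "real \<Rightarrow> real \<Rightarrow> real^('e::finite + 'i::finite)^('e + 'i)"
  where "H_mat \<alpha> \<mu> = block_mat
    (\<mu> *\<^sub>R K_mat)    ((- \<alpha> * \<mu>) *\<^sub>R ones_mat)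
    (\<mu> *\<^sub>R ones_mat) ((- \<alpha> * \<mu>) *\<^sub>R K_mat)"

definition tanh_vec :: "real^'n \<Rightarrow> real^'n"
  where "tanh_vec v = (\<chi> i. tanh (v $ i))"

definition network_field ::
    "real \<Rightarrow> real \<Rightarrow> real \<Rightarrow> real^('e::finite + 'i::finite) \<Rightarrow> real^('e + 'i)"
  where "network_field \<alpha> \<mu> g v =
    - v + (1 / sqrt (real CARD('e + 'i))) *\<^sub>R (H_mat \<alpha> \<mu> *v tanh_vec (g *\<^sub>R v))"

end

theory Submission
  imports Defs
begin

text \<open>On the synchronous plane \<open>(u, v)\<close> the origin is an unstable focus, the field points inwards far
  out, and, since \<open>tanh\<close> is monotone, every nonzero orbit rotates strictly around the origin. Using the
  angle as independent variable, orbits become solutions of a scalar differential equation with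
  periodic coefficients. A solution starting near the origin lies below its translate by a full turn;
  as solutions of a scalar equation do not cross, its translates increase to a periodic solution.
  This periodic solution is the limit cycle, and it is the \<open>\<omega>\<close>-limit set of the orbit started near the
  origin.\<close>

section \<open>Scalar differential equations\<close>

text \<open>The radial coordinate is a logarithm \<rho>: the origin moves to minus infinity, and the
  equation for \<rho> over the angle, once truncated above, is a scalar equation on the whole line
  with bounded, globally Lipschitz right-hand side. The price is a factor
  \<open>exp (- \<rho>)\<close>, which is cancelled by |tanh s| <= |s|. Instability of the origin
  does not make the Euclidean radius grow: along the inhibitory axis the linearised radial speed is
  -1 - c g (n - \<alpha>) < 0. The radius is therefore measured by ellipses adapted to the
  linearisation, for which the radial speed near the origin tends to half the trace at every angle.
  With c = \<mu> / sqrt N the trace c g (\<alpha> - 1) - 2 is positive exactly when g > g_H. Far out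
  the angular speed tends to 0 because \<open>tanh\<close> saturates, so the angle is a good clock
  only below a fixed level M; this forces the truncation and the bound \<open>\<phi> t < M\<close>.
  A limit cycle must attract one orbit off it; the orbit from the inside serves for that.\<close>

lemma continuous_on_lipschitz_comp:
  fixes f :: "real \<Rightarrow> real \<Rightarrow> real"
  assumes lip: "\<And>x y t. \<bar>f x t - f y t\<bar> \<le> L * \<bar>x - y\<bar>"
    and cont: "\<And>x. continuous_on UNIV (f x)" and z: "continuous_on UNIV z"
  shows "continuous_on UNIV (\<lambda>t. f (z t) t)"
proof -
  have "((\<lambda>t. f (z t) t) \<longlongrightarrow> f (z s) s) (at s)" for s
  proof -
    have zs: "(z \<longlongrightarrow> z s) (at s)" and fs: "(f (z s) \<longlongrightarrow> f (z s) s) (at s)"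
      using z cont[of "z s"] by (auto simp: continuous_on_def)
    have "((\<lambda>t. L * \<bar>z t - z s\<bar>) \<longlongrightarrow> L * \<bar>z s - z s\<bar>) (at s)"
      by (intro tendsto_intros zs)
    then have lim: "((\<lambda>t. L * \<bar>z t - z s\<bar>) \<longlongrightarrow> 0) (at s)" by simp
    \<comment> \<open>The change of state is absorbed by the Lipschitz bound, uniformly in t; in the
      remaining term \<open>fs\<close> the state is frozen at \<open>z s\<close>.\<close>
    have "((\<lambda>t. f (z t) t - f (z s) t) \<longlongrightarrow> 0) (at s)"
      by (rule Lim_null_comparison[OF always_eventually lim]) (simp add: lip)
    from tendsto_add[OF this fs] show ?thesis by simp
  qed
  then show ?thesis by (simp add: continuous_on_def)
qed

lemma antiderivative_at_0:
  fixes f :: "real \<Rightarrow> real"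
  assumes "continuous_on UNIV f"
  shows "\<exists>F. F 0 = 0 \<and> (\<forall>t. (F has_real_derivative f t) (at t))"
proof -
  have "isCont f x" for x
    using assms continuous_on_eq_continuous_at by blast
  then obtain F where F: "\<And>t. (F has_vector_derivative f t) (at t)"
    using einterval_antiderivative[of "-\<infinity>" "\<infinity>" f] by auto
  have "((\<lambda>t. F t - F 0) has_real_derivative f t) (at t)" for t
    using F[of t] by (auto simp: has_real_derivative_iff_has_vector_derivative
        intro!: derivative_eq_intros)
  then show ?thesis by (intro exI[of _ "\<lambda>t. F t - F 0"]) auto
qed

text \<open>The antiderivative of cosh (K t) is sinh (K t) / K and |sinh| <= cosh, so integration
  gains a factor 1 / K in the weighted norm. The weight cosh is smooth and even, which treats both
  time directions at once.\<close>

lemma antiderivative_le_cosh: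
  fixes f F :: "real \<Rightarrow> real"
  assumes F: "\<And>t. (F has_real_derivative f t) (at t)" "F 0 = 0"
    and "K > 0" "D \<ge> 0" and f: "\<And>t. \<bar>f t\<bar> \<le> D * cosh (K * t)"
  shows "\<bar>F t\<bar> \<le> D / K * cosh (K * t)"
proof -
  have le: "\<bar>F t\<bar> \<le> D / K * \<bar>sinh (K * t)\<bar>"
  proof -
    define P where "P = (\<lambda>t. D / K * sinh (K * t) - F t)"
    define Q where "Q = (\<lambda>t. D / K * sinh (K * t) + F t)"
    have P: "(P has_real_derivative D * cosh (K * t) - f t) (at t)" for t
      unfolding P_def using \<open>K > 0\<close> by (auto intro!: derivative_eq_intros F(1))
    have Q: "(Q has_real_derivative D * cosh (K * t) + f t) (at t)" for t
      unfolding Q_def using \<open>K > 0\<close> by (auto intro!: derivative_eq_intros F(1))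
    have mono: "P x \<le> P y" "Q x \<le> Q y" if "x \<le> y" for x y
    proof -
      have f': "f u \<le> D * cosh (K * u)" "- f u \<le> D * cosh (K * u)" for u
        using f[of u] by linarith+
      show "P x \<le> P y"
        by (rule DERIV_nonneg_imp_nondecreasing[OF that]) (use P f'(1) in \<open>metis diff_ge_0_iff_ge\<close>)
      show "Q x \<le> Q y"
        by (rule DERIV_nonneg_imp_nondecreasing[OF that])
          (use Q f'(2) in \<open>metis diff_ge_0_iff_ge diff_minus_eq_add\<close>)
    qed
    have PQ0: "P 0 = 0" "Q 0 = 0" by (simp_all add: P_def Q_def F(2))
    show ?thesis
    proof (cases "t \<ge> 0")
      case True
      then have "0 \<le> sinh (K * t)" using \<open>K > 0\<close> by simp
      then show ?thesis using mono(1)[OF True] mono(2)[OF True] PQ0 unfolding P_def Q_def by auto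
    next
      case False
      then have "sinh (K * t) < 0" using \<open>K > 0\<close> by (simp add: mult_pos_neg)
      then show ?thesis using mono(1)[of t 0] mono(2)[of t 0] False PQ0
        unfolding P_def Q_def by auto
    qed
  qed
  have "\<bar>sinh (K * t)\<bar> \<le> cosh (K * t)"
    using sinh_le_cosh_real[of "K * t"] sinh_le_cosh_real[of "- (K * t)"] by (simp add: abs_le_iff)
  then have "D / K * \<bar>sinh (K * t)\<bar> \<le> D / K * cosh (K * t)"
    using \<open>K > 0\<close> \<open>D \<ge> 0\<close> by (intro mult_left_mono) auto
  with le show ?thesis by linarith
qed

text \<open>Picard--Lindelof on the whole line: in the unknown \<open>(x - a) / cosh (K t)\<close> the integral
  operator is a contraction of the bounded continuous functions once \<open>K > L\<close>.\<close>

lemma lipschitz_ode_solution: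
  fixes f :: "real \<Rightarrow> real \<Rightarrow> real"
  assumes lip: "\<And>x y t. \<bar>f x t - f y t\<bar> \<le> L * \<bar>x - y\<bar>"
    and cont: "\<And>x. continuous_on UNIV (f x)" and bd: "\<And>x t. \<bar>f x t\<bar> \<le> B"
  obtains x where "x 0 = a" "\<And>t. (x has_real_derivative f (x t) t) (at t)"
proof -
  \<comment> \<open>The factor 2 yields the contraction constant 1/2; the summand 1 keeps K positive
    when L = 0.\<close>
  define K where "K = 2 * (\<bar>L\<bar> + 1)"
  have K: "K > 0" "L / K \<le> 1 / 2" by (auto simp: K_def field_simps)
  have "L * \<bar>x - y\<bar> \<ge> 0" for x y using lip[of x _ y] by (smt (verit))
  from this[of 1 0] have L0: "L \<ge> 0" by simp
  have B0: "B \<ge> 0" using bd[of 0 0] by linarith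
  obtain I where I: "\<And>h :: real \<Rightarrow> real. continuous_on UNIV h \<Longrightarrow>
      I h 0 = 0 \<and> (\<forall>t. (I h has_real_derivative h t) (at t))"
    using antiderivative_at_0 by metis
  define g where "g = (\<lambda>(z :: real \<Rightarrow>\<^sub>C real) t. f (a + cosh (K * t) * z t) t)"
  have g_cont: "continuous_on UNIV (g z)" for z
    unfolding g_def by (intro continuous_on_lipschitz_comp[OF lip cont] continuous_intros) auto
  have g_bd: "\<bar>g z t\<bar> \<le> B * cosh (K * t)" for z t
    using bd[of "a + cosh (K * t) * z t" t] B0 cosh_real_ge_1[of "K * t"]
      mult_left_mono[of 1 "cosh (K * t)" B] by (simp add: g_def)
  define T where "T = (\<lambda>z. Bcontfun (\<lambda>t. I (g z) t / cosh (K * t)))"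
  \<comment> \<open>Here the bound B on f enters: since cosh >= 1, the integrand lies below B cosh
    (K t), and the image is bounded by B / K.\<close>
  have in_bc: "(\<lambda>t. I (g z) t / cosh (K * t)) \<in> bcontfun" for z
  proof -
    have "continuous_on UNIV (I (g z))"
      using I[OF g_cont] DERIV_isCont continuous_at_imp_continuous_on by blast
    moreover have "\<bar>I (g z) t / cosh (K * t)\<bar> \<le> B / K" for t
      using antiderivative_le_cosh[OF _ _ K(1) B0 g_bd[of z], of "I (g z)" t] I[OF g_cont[of z]]
      by (simp add: abs_divide pos_divide_le_eq)
    ultimately show ?thesis
      unfolding bcontfun_def by (auto intro!: continuous_intros boundedI[of _ "B / K"])
  qed
  have T: "T z t = I (g z) t / cosh (K * t)" for z t
    unfolding T_def by (simp add: Bcontfun_inverse[OF in_bc])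
  have "dist (T z) (T w) \<le> 1 / 2 * dist z w" for z w
  proof (rule dist_bound)
    fix t
    have d: "\<bar>g z s - g w s\<bar> \<le> L * dist z w * cosh (K * s)" for s
    proof -
      have "\<bar>g z s - g w s\<bar> \<le> L * \<bar>cosh (K * s) * (z s - w s)\<bar>"
        using lip[of "a + cosh (K * s) * z s" s "a + cosh (K * s) * w s"]
        by (simp add: g_def algebra_simps)
      also have "\<dots> = L * (\<bar>z s - w s\<bar> * cosh (K * s))" by (simp add: abs_mult)
      also have "\<dots> \<le> L * (dist z w * cosh (K * s))"
        using dist_bounded[of z s w] L0 by (intro mult_left_mono mult_right_mono) (auto simp: dist_real_def)
      finally show ?thesis by simp
    qed
    have "\<bar>I (g z) t - I (g w) t\<bar> \<le> L * dist z w / K * cosh (K * t)"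
      by (rule antiderivative_le_cosh[OF _ _ K(1) _ d])
        (use I[OF g_cont] L0 in \<open>auto intro!: derivative_intros\<close>)
    then have "dist (T z t) (T w t) \<le> L / K * dist z w"
      by (simp add: T dist_real_def flip: diff_divide_distrib) (simp add: abs_divide pos_divide_le_eq)
    also have "\<dots> \<le> 1 / 2 * dist z w" using K by (intro mult_right_mono) auto
    finally show "dist (T z t) (T w t) \<le> 1 / 2 * dist z w" .
  qed
  then obtain z where z: "T z = z" using banach_fix_type[of "1 / 2" T] by auto
  define x where "x = (\<lambda>t. a + I (g z) t)"
  have x: "x t = a + cosh (K * t) * z t" for t
    using T[of z t] by (simp add: z x_def)
  have "(x has_real_derivative f (x t) t) (at t)" for t
  proof -
    have "(I (g z) has_real_derivative f (x t) t) (at t)"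
      using I[OF g_cont[of z]] by (simp add: x g_def)
    then show ?thesis unfolding x_def by (auto intro!: derivative_eq_intros)
  qed
  moreover have "x 0 = a" using I[OF g_cont[of z]] by (simp add: x_def)
  ultimately show ?thesis using that by blast
qed

text \<open>The squared difference is differentiable where the absolute value need not be.
  Multiplied by exp (-2 L t) it decreases, multiplied by exp (2 L t) it increases; this gives the
  estimate forwards and backwards from s.\<close>

lemma lipschitz_ode_gronwall:
  fixes f :: "real \<Rightarrow> real \<Rightarrow> real"
  assumes lip: "\<And>x y t. \<bar>f x t - f y t\<bar> \<le> L * \<bar>x - y\<bar>"
    and x: "\<And>t. (x has_real_derivative f (x t) t) (at t)"
    and y: "\<And>t. (y has_real_derivative f (y t) t) (at t)"
  shows "\<bar>x t - y t\<bar> \<le> exp (L * \<bar>t - s\<bar>) * \<bar>x s - y s\<bar>"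
proof -
  define w where "w = (\<lambda>t. x t - y t)"
  define w' where "w' = (\<lambda>t. f (x t) t - f (y t) t)"
  have w: "(w has_real_derivative w' t) (at t)" for t
    unfolding w_def w'_def by (intro derivative_intros x y)
  have ww: "\<bar>w t * w' t\<bar> \<le> L * (w t)\<^sup>2" for t
  proof -
    have "\<bar>w t * w' t\<bar> \<le> \<bar>w t\<bar> * (L * \<bar>w t\<bar>)"
      unfolding abs_mult w_def w'_def by (intro mult_left_mono lip) simp
    then show ?thesis by (simp add: power2_eq_square mult.left_commute)
  qed
  have A: "((\<lambda>t. (w t)\<^sup>2 * exp (c * t)) has_real_derivative (2 * (w t * w' t) + c * (w t)\<^sup>2) * exp (c * t)) (at t)"
    for c t by (auto intro!: derivative_eq_intros w simp: algebra_simps)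
  have fin: "(w t)\<^sup>2 \<le> (exp (L * \<bar>t - s\<bar>) * w s)\<^sup>2"
    if "(w t)\<^sup>2 * exp (c * t) \<le> (w s)\<^sup>2 * exp (c * s)" "c * (s - t) = 2 * (L * \<bar>t - s\<bar>)" for c
  proof -
    have "(w t)\<^sup>2 \<le> (w s)\<^sup>2 * exp (c * (s - t))"
      using that(1) by (simp add: right_diff_distrib exp_diff pos_le_divide_eq)
    then show ?thesis
      unfolding that(2) exp_double power_mult_distrib by (simp add: mult.commute)
  qed
  have sq: "(w t)\<^sup>2 \<le> (exp (L * \<bar>t - s\<bar>) * w s)\<^sup>2"
  proof (cases "t \<ge> s")
    case True
    have "(w t)\<^sup>2 * exp (- 2 * L * t) \<le> (w s)\<^sup>2 * exp (- 2 * L * s)"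
    proof (rule DERIV_nonpos_imp_nonincreasing[OF True])
      fix u
      have "(2 * (w u * w' u) + (- 2 * L) * (w u)\<^sup>2) * exp (- 2 * L * u) \<le> 0"
        using ww[of u] by (intro mult_nonpos_nonneg) (auto simp: abs_le_iff)
      then show "\<exists>D. ((\<lambda>t. (w t)\<^sup>2 * exp (- 2 * L * t)) has_real_derivative D) (at u) \<and> D \<le> 0"
        using A[of "- 2 * L" u] by blast
    qed
    then show ?thesis using fin[of "- 2 * L"] True by (simp add: algebra_simps)
  next
    case False
    then have ts: "t \<le> s" by simp
    have "(w t)\<^sup>2 * exp (2 * L * t) \<le> (w s)\<^sup>2 * exp (2 * L * s)"
    proof (rule DERIV_nonneg_imp_nondecreasing[OF ts])
      fix u
      have "0 \<le> (2 * (w u * w' u) + 2 * L * (w u)\<^sup>2) * exp (2 * L * u)"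
        using ww[of u] by (intro mult_nonneg_nonneg) (auto simp: abs_le_iff)
      then show "\<exists>D. ((\<lambda>t. (w t)\<^sup>2 * exp (2 * L * t)) has_real_derivative D) (at u) \<and> 0 \<le> D"
        using A[of "2 * L" u] by blast
    qed
    then show ?thesis using fin[of "2 * L"] ts by (simp add: algebra_simps)
  qed
  then have "\<bar>w t\<bar> \<le> \<bar>exp (L * \<bar>t - s\<bar>) * w s\<bar>" by (simp add: abs_le_square_iff)
  then show ?thesis by (simp add: w_def abs_mult)
qed

text \<open>If the order changed, the difference would vanish at some time u, and Gronwall started
  at u would force equality at s.\<close>

lemma lipschitz_ode_less:
  fixes f :: "real \<Rightarrow> real \<Rightarrow> real"
  assumes lip: "\<And>x y t. \<bar>f x t - f y t\<bar> \<le> L * \<bar>x - y\<bar>"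
    and x: "\<And>t. (x has_real_derivative f (x t) t) (at t)"
    and y: "\<And>t. (y has_real_derivative f (y t) t) (at t)"
    and less: "x s < y s"
  shows "x t < y t"
proof (rule ccontr)
  assume "\<not> x t < y t"
  define w where "w = (\<lambda>t. y t - x t)"
  have w: "isCont w u" for u
    unfolding w_def using x y DERIV_isCont by (intro continuous_intros) blast+
  have "w s > 0" "w t \<le> 0" using less \<open>\<not> x t < y t\<close> by (auto simp: w_def)
  then obtain u where "w u = 0"
    using IVT[of w t 0 s] IVT2[of w t 0 s] w
    by (metis (no_types, opaque_lifting) IVT2 less_eq_real_def linorder_le_cases)
  then have "\<bar>x s - y s\<bar> \<le> exp (L * \<bar>s - u\<bar>) * \<bar>x u - y u\<bar>" "x u = y u"
    using lipschitz_ode_gronwall[OF lip x y, of s u] by (auto simp: w_def)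
  then show False using less by simp
qed

section \<open>Periodic scalar equations and the angle as clock\<close>

lemma periodic_reduce:
  fixes t :: real
  assumes "P > 0"
  obtains k :: int where "0 \<le> t - of_int k * P" "t - of_int k * P \<le> P"
proof -
  have "of_int \<lfloor>t / P\<rfloor> \<le> t / P" "t / P \<le> of_int \<lfloor>t / P\<rfloor> + 1" by linarith+
  then obtain k :: int where "of_int k \<le> t / P" "t / P \<le> of_int k + 1" by blast
  then have "0 \<le> t - of_int k * P" "t - of_int k * P \<le> P"
    using assms by (simp_all add: field_simps)
  then show ?thesis by (rule that)
qed

lemma periodic_of_int:
  fixes h :: "real \<Rightarrow> 'a"
  assumes "\<And>t. h (t + P) = h t"
  shows "h (t + of_int k * P) = h t" "h (t - of_int k * P) = h t"
proof -
  interpret periodic_fun_simple h P by unfold_locales (rule assms)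
  show "h (t + of_int k * P) = h t" "h (t - of_int k * P) = h t"
    by (rule plus_of_int minus_of_int)+
qed

text \<open>Scalar form of the result: \<phi> becomes the cycle, \<psi> the orbit winding onto it
  from inside. The bound by M is recorded so that a truncation of f above M can be undone on both
  solutions.\<close>

lemma periodic_ode_connection:
  fixes f :: "real \<Rightarrow> real \<Rightarrow> real"
  assumes lip: "\<And>x y t. \<bar>f x t - f y t\<bar> \<le> L * \<bar>x - y\<bar>"
    and cont: "\<And>x. continuous_on UNIV (f x)" and bd: "\<And>x t. \<bar>f x t\<bar> \<le> B"
    and "P > 0" and per: "\<And>x t. f x (t + P) = f x t"
    and low: "\<And>x t. x \<le> m \<Longrightarrow> 0 < f x t" and high: "\<And>x t. M \<le> x \<Longrightarrow> f x t < 0"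
  obtains \<phi> \<psi> where
    "\<And>t. (\<phi> has_real_derivative f (\<phi> t) t) (at t)" "\<And>t. (\<psi> has_real_derivative f (\<psi> t) t) (at t)"
    "\<And>t. \<phi> (t + P) = \<phi> t" "\<And>t. \<psi> t < \<phi> t" "\<And>t. \<phi> t < M"
    "((\<lambda>t. \<phi> t - \<psi> t) \<longlongrightarrow> 0) at_top"
proof -
  have "L * \<bar>1 - 0\<bar> \<ge> 0" using lip[of 1 _ 0] abs_ge_zero order_trans by blast
  then have L0: "L \<ge> 0" by simp
  \<comment> \<open>The speed is at most B, so from m - B P the solution stays below m for a whole
    period and increases throughout it.\<close>
  obtain \<psi> where \<psi>0: "\<psi> 0 = m - B * P" and \<psi>: "\<And>t. (\<psi> has_real_derivative f (\<psi> t) t) (at t)"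
    using lipschitz_ode_solution[OF lip cont bd] by metis
  have \<psi>_lip: "\<bar>\<psi> t - \<psi> s\<bar> \<le> B * \<bar>t - s\<bar>" for s t
    using field_differentiable_bound[of UNIV \<psi> "\<lambda>t. f (\<psi> t) t" B t s] \<psi> bd by simp
  have \<psi>_shift: "((\<lambda>t. \<psi> (t + c)) has_real_derivative f (\<psi> (t + c)) (t + c)) (at t)" for c t
    using \<psi>[of "t + c"] by (simp add: DERIV_shift)
  have B0: "B \<ge> 0" using bd[of 0 0] by linarith
  have BP: "B * u \<le> B * P" if "u \<le> P" for u using B0 that by (rule mult_left_mono[rotated])
  have "\<psi> 0 < \<psi> P"
  proof (rule DERIV_pos_imp_increasing[OF \<open>P > 0\<close>])
    fix t assume "0 \<le> t" "t \<le> P"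
    then have "\<psi> t \<le> m" using \<psi>_lip[of t 0] \<psi>0 BP[of t] by auto
    then show "\<exists>d. (\<psi> has_real_derivative d) (at t) \<and> 0 < d" using \<psi> low by blast
  qed
  then have mono: "\<psi> t < \<psi> (t + P)" for t
    using lipschitz_ode_less[OF lip \<psi>, of "\<lambda>t. \<psi> (t + P)" 0 t] \<psi>_shift[of P] per by simp
  define a where "a = (\<lambda>k. \<psi> (real k * P))"
  have inc: "incseq (\<lambda>k. \<psi> (t + real k * P))" for t
    using mono[of "t + real k * P" for k] by (intro incseq_SucI) (simp add: algebra_simps less_imp_le)
  \<comment> \<open>The mirror image of the initial value: above M + B P the solution would stay
    above M for the next period and decrease, against \<open>mono\<close>.\<close>
  have a_bd: "a k \<le> M + B * P" for k
  proof (rule ccontr)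
    assume *: "\<not> a k \<le> M + B * P"
    have "\<psi> (real k * P + P) < \<psi> (real k * P)"
    proof (rule DERIV_neg_imp_decreasing[of "real k * P" "real k * P + P" \<psi>])
      fix t assume "real k * P \<le> t" "t \<le> real k * P + P"
      then have "M \<le> \<psi> t" using \<psi>_lip[of t "real k * P"] * BP[of "t - real k * P"] by (auto simp: a_def)
      then show "\<exists>d. (\<psi> has_real_derivative d) (at t) \<and> d < 0" using \<psi> high by blast
    qed (use \<open>P > 0\<close> in simp)
    with mono[of "real k * P"] show False by simp
  qed
  have "incseq a" using inc[of 0] by (simp add: a_def)
  then obtain A where A: "a \<longlonglongrightarrow> A"
    using incseq_convergent[of a "M + B * P"] a_bd by metis
  obtain \<phi> where \<phi>0: "\<phi> 0 = A" and \<phi>: "\<And>t. (\<phi> has_real_derivative f (\<phi> t) t) (at t)"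
    using lipschitz_ode_solution[OF lip cont bd] by metis
  have per_k: "f x (t + real k * P) = f x t" for x t k
    using periodic_of_int(1)[of "f x" P t "int k"] per by simp
  \<comment> \<open>Translates by whole periods solve the same equation, so convergence of their
    values at time 0 propagates to every t.\<close>
  have near: "\<bar>\<psi> (t + real k * P) - \<phi> t\<bar> \<le> exp (L * \<bar>t\<bar>) * \<bar>a k - A\<bar>" for t k
    using lipschitz_ode_gronwall[OF lip _ \<phi>, of "\<lambda>t. \<psi> (t + real k * P)" t 0]
      \<psi>_shift[of "real k * P"] \<phi>0 by (simp add: a_def per_k)
  have lim: "(\<lambda>k. \<psi> (t + real k * P)) \<longlonglongrightarrow> \<phi> t" for t
  proof -
    have "(\<lambda>k. \<bar>a k - A\<bar>) \<longlonglongrightarrow> 0"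
      using A by (intro tendsto_rabs_zero) (simp add: LIM_zero)
    then have "(\<lambda>k. exp (L * \<bar>t\<bar>) * \<bar>a k - A\<bar>) \<longlonglongrightarrow> 0"
      by (rule tendsto_mult_right_zero)
    then have "(\<lambda>k. \<psi> (t + real k * P) - \<phi> t) \<longlonglongrightarrow> 0"
      by (rule Lim_null_comparison[rotated]) (simp add: near)
    then show ?thesis by (simp add: LIM_zero_iff)
  qed
  have \<phi>_per: "\<phi> (t + P) = \<phi> t" for t
  proof (rule LIMSEQ_unique)
    show "(\<lambda>k. \<psi> (t + real (Suc k) * P)) \<longlonglongrightarrow> \<phi> t" by (rule LIMSEQ_Suc[OF lim])
    show "(\<lambda>k. \<psi> (t + real (Suc k) * P)) \<longlonglongrightarrow> \<phi> (t + P)"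
      using lim[of "t + P"] by (simp add: algebra_simps)
  qed
  have \<psi>\<phi>: "\<psi> t < \<phi> t" for t
    using mono[of t] incseq_le[OF inc lim, of t 1] by simp
  \<comment> \<open>By periodicity the maximum over one period is global; there the derivative
    vanishes, which is impossible at level M or above.\<close>
  have \<phi>_less: "\<phi> t < M" for t
  proof -
    have "continuous_on {0..P} \<phi>"
      using \<phi> DERIV_isCont continuous_at_imp_continuous_on by blast
    moreover have "{0..P} \<noteq> {}" using \<open>P > 0\<close> by simp
    ultimately obtain s where s: "\<And>u. u \<in> {0..P} \<Longrightarrow> \<phi> u \<le> \<phi> s"
      using continuous_attains_sup[OF compact_Icc] by blast
    have max: "\<phi> u \<le> \<phi> s" for u
    proof -
      obtain k :: int where "0 \<le> u - of_int k * P" "u - of_int k * P \<le> P"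
        using periodic_reduce[OF \<open>P > 0\<close>] by blast
      then show ?thesis using s[of "u - of_int k * P"] periodic_of_int(2)[of \<phi>, OF \<phi>_per] by simp
    qed
    then have "f (\<phi> s) s = 0" using DERIV_local_max[OF \<phi>, of 1] by simp
    then have "\<phi> s < M" using high by (metis less_irrefl not_le)
    with max[of t] show ?thesis by simp
  qed
  have "((\<lambda>t. \<phi> t - \<psi> t) \<longlongrightarrow> 0) at_top"
  proof (rule tendstoI)
    fix e :: real assume "e > 0"
    then have "e / exp (L * P) > 0" by simp
    then obtain k0 where k0: "\<And>k. k \<ge> k0 \<Longrightarrow> \<bar>a k - A\<bar> < e / exp (L * P)"
      using A unfolding lim_sequentially dist_real_def by blast
    \<comment> \<open>The extra period allows for the closed right end in
      \<open>periodic_reduce\<close>: from t - j P <= P one only gets j >= k0. The estimate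
      \<open>near\<close> is then used on [0, P] alone, where its factor is at most exp (L
      P).\<close>
    have "dist (\<phi> t - \<psi> t) 0 < e" if t: "t \<ge> real (Suc k0) * P" for t
    proof -
      obtain j :: int where j: "0 \<le> t - of_int j * P" "t - of_int j * P \<le> P"
        using periodic_reduce[OF \<open>P > 0\<close>] by blast
      then have "real_of_int (int k0 + 1) * P \<le> of_int (j + 1) * P" using t by (simp add: algebra_simps)
      then have "int k0 + 1 \<le> j + 1" using \<open>P > 0\<close> by (simp only: mult_le_cancel_right_pos of_int_le_iff)
      then have "j = int (nat j)" "k0 \<le> nat j" by auto
      then obtain k where k: "j = int k" "k \<ge> k0" by blast
      define s where "s = t - real k * P"
      have s: "0 \<le> s" "s \<le> P" "t = s + real k * P" using j k by (auto simp: s_def)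
      have "\<bar>\<psi> t - \<phi> t\<bar> \<le> exp (L * s) * \<bar>a k - A\<bar>"
        using near[of s k] s periodic_of_int(1)[of \<phi>, OF \<phi>_per, of s "int k"] by simp
      also have "\<dots> \<le> exp (L * P) * \<bar>a k - A\<bar>"
        using s L0 by (intro mult_right_mono) (auto intro: mult_left_mono)
      also have "\<dots> < e" using k0[OF k(2)] by (simp add: field_simps)
      finally show ?thesis by (simp add: dist_real_def)
    qed
    then show "\<forall>\<^sub>F t in at_top. dist (\<phi> t - \<psi> t) 0 < e"
      unfolding eventually_at_top_linorder by blast
  qed
  then show ?thesis using that[OF \<phi> \<psi> \<phi>_per \<psi>\<phi> \<phi>_less] by blast
qed

text \<open>\<tau> s is the time at which the angle s is reached, an antiderivative of 1 / \<omega>;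
  \<Theta> is its inverse. The upper bound C makes \<tau> grow at least linearly, hence onto the
  line, so the orbit is defined for all times.\<close>

lemma autonomous_time_change:
  fixes \<omega> :: "real \<Rightarrow> real"
  assumes cont: "continuous_on UNIV \<omega>" and "\<delta> > 0" and \<omega>: "\<And>s. \<delta> \<le> \<omega> s" "\<And>s. \<omega> s \<le> C"
  obtains \<Theta> \<tau> where "\<And>s. \<Theta> (\<tau> s) = s" "\<And>t. \<tau> (\<Theta> t) = t"
    "\<And>t. (\<Theta> has_real_derivative \<omega> (\<Theta> t)) (at t)" "\<And>s. (\<tau> has_real_derivative 1 / \<omega> s) (at s)"
    "strict_mono \<tau>" "filterlim \<Theta> at_top at_top" "filterlim \<tau> at_top at_top"
proof -
  have pos: "\<omega> s > 0" for s using \<open>\<delta> > 0\<close> \<omega>(1)[of s] by linarith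
  have "C > 0" using pos[of 0] \<omega>(2)[of 0] by linarith
  have "continuous_on UNIV (\<lambda>s. 1 / \<omega> s)"
    using pos by (intro continuous_intros cont) (auto simp: less_imp_neq[THEN not_sym])
  then obtain \<tau> where \<tau>0: "\<tau> 0 = 0" and \<tau>: "\<And>s. (\<tau> has_real_derivative 1 / \<omega> s) (at s)"
    using antiderivative_at_0 by meson
  have \<tau>_grow: "(t - s) / C \<le> \<tau> t - \<tau> s" if "s \<le> t" for s t
  proof -
    have "\<tau> s - s / C \<le> \<tau> t - t / C"
    proof (rule DERIV_nonneg_imp_nondecreasing[OF that])
      fix u
      have "((\<lambda>t. \<tau> t - t / C) has_real_derivative 1 / \<omega> u - 1 / C) (at u)"
        by (use \<open>C > 0\<close> in \<open>auto intro!: derivative_eq_intros \<tau>\<close>)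
      moreover have "0 \<le> 1 / \<omega> u - 1 / C" using pos[of u] \<omega>(2)[of u] frac_le[of 1 1 "\<omega> u" C] by simp
      ultimately show "\<exists>d. ((\<lambda>t. \<tau> t - t / C) has_real_derivative d) (at u) \<and> 0 \<le> d" by blast
    qed
    then show ?thesis by (simp add: diff_divide_distrib)
  qed
  have sm: "strict_mono \<tau>"
  proof (rule strict_monoI)
    fix s t :: real assume "s < t"
    then show "\<tau> s < \<tau> t" using \<tau>_grow[of s t] \<open>C > 0\<close> divide_pos_pos[of "t - s" C] by linarith
  qed
  have \<tau>_cont: "isCont \<tau> s" for s using \<tau> DERIV_isCont by blast
  have "\<exists>s. \<tau> s = t" for t
  proof -
    have "\<bar>t\<bar> \<le> \<tau> (C * \<bar>t\<bar>)" using \<tau>_grow[of 0 "C * \<bar>t\<bar>"] \<tau>0 \<open>C > 0\<close> by simp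
    moreover have "\<tau> (- (C * \<bar>t\<bar>)) \<le> - \<bar>t\<bar>" using \<tau>_grow[of "- (C * \<bar>t\<bar>)" 0] \<tau>0 \<open>C > 0\<close> by simp
    ultimately show ?thesis
      using IVT[of \<tau> "- (C * \<bar>t\<bar>)" t "C * \<bar>t\<bar>"] \<tau>_cont \<open>C > 0\<close> by fastforce
  qed
  then obtain \<Theta> where r: "\<And>t. \<tau> (\<Theta> t) = t" by metis
  then have l: "\<Theta> (\<tau> s) = s" for s using strict_mono_eq[OF sm] by blast
  have \<Theta>: "(\<Theta> has_real_derivative \<omega> (\<Theta> t)) (at t)" for t
  proof -
    have "isCont \<Theta> (\<tau> (\<Theta> t))"
      by (rule isCont_inverse_function[where d = 1]) (use l \<tau>_cont in auto)
    then have "(\<Theta> has_real_derivative inverse (1 / \<omega> (\<Theta> t))) (at t)"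
      using has_field_derivative_inverse_basic[of \<tau> "1 / \<omega> (\<Theta> t)" \<Theta> t UNIV] \<tau> pos[of "\<Theta> t"] r by simp
    then show ?thesis by simp
  qed
  have "filterlim \<Theta> at_top at_top"
    unfolding filterlim_at_top eventually_at_top_linorder
    using strict_mono_less_eq[OF sm] r by metis
  moreover have "filterlim \<tau> at_top at_top"
    unfolding filterlim_at_top eventually_at_top_linorder
    using strict_mono_less_eq[OF sm] r by metis
  ultimately show ?thesis using that[OF l r \<Theta> \<tau> sm] by blast
qed

section \<open>Limit cycles in polar coordinates\<close>

text \<open>Boundedness is part of the class because it makes products Lipschitz again. Closure
  under sums, products and inverses of functions bounded away from 0 lets the coefficients of the
  network be checked by their syntactic form.\<close>

definition lipschitz_coefficient :: "real \<Rightarrow> (real \<Rightarrow> real \<Rightarrow> real) \<Rightarrow> bool"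
  where "lipschitz_coefficient P f \<longleftrightarrow>
    (\<exists>L. \<forall>x y t. \<bar>f x t - f y t\<bar> \<le> L * \<bar>x - y\<bar>) \<and> (\<exists>B. \<forall>x t. \<bar>f x t\<bar> \<le> B) \<and>
    (\<forall>x. continuous_on UNIV (f x)) \<and> (\<forall>x t. f x (t + P) = f x t)"

lemma lipschitz_coefficientI:
  assumes "\<And>x y t. \<bar>f x t - f y t\<bar> \<le> L * \<bar>x - y\<bar>" "\<And>x t. \<bar>f x t\<bar> \<le> B"
    "\<And>x. continuous_on UNIV (f x)" "\<And>x t. f x (t + P) = f x t"
  shows "lipschitz_coefficient P f"
  using assms unfolding lipschitz_coefficient_def by blast

lemma lipschitz_coefficientE:
  assumes "lipschitz_coefficient P f"
  obtains L B where "L \<ge> 0" "B \<ge> 0" "\<And>x y t. \<bar>f x t - f y t\<bar> \<le> L * \<bar>x - y\<bar>" "\<And>x t. \<bar>f x t\<bar> \<le> B"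
    "\<And>x. continuous_on UNIV (f x)" "\<And>x t. f x (t + P) = f x t"
proof -
  obtain L B where *: "\<And>x y t. \<bar>f x t - f y t\<bar> \<le> L * \<bar>x - y\<bar>" "\<And>x t. \<bar>f x t\<bar> \<le> B"
    using assms unfolding lipschitz_coefficient_def by blast
  have "L * \<bar>1 - 0\<bar> \<ge> 0" using *(1)[of 1 _ 0] abs_ge_zero order_trans by blast
  moreover have "B \<ge> 0" using *(2)[of 0 0] by linarith
  ultimately show ?thesis
    using that[of L B] * assms unfolding lipschitz_coefficient_def by simp
qed

lemma lipschitz_coefficient_time_only:
  assumes "continuous_on UNIV h" "\<And>t. \<bar>h t\<bar> \<le> B" "\<And>t. h (t + P) = h t"
  shows "lipschitz_coefficient P (\<lambda>x. h)"
  using assms by (intro lipschitz_coefficientI[of _ 0 B]) auto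

lemma lipschitz_coefficient_const: "lipschitz_coefficient P (\<lambda>x t. c)"
  by (rule lipschitz_coefficient_time_only[of _ "\<bar>c\<bar>"]) auto

lemma lipschitz_coefficient_add:
  assumes "lipschitz_coefficient P f" "lipschitz_coefficient P g"
  shows "lipschitz_coefficient P (\<lambda>x t. f x t + g x t)"
proof -
  from assms(1) obtain L B where f: "\<And>x y t. \<bar>f x t - f y t\<bar> \<le> L * \<bar>x - y\<bar>" "\<And>x t. \<bar>f x t\<bar> \<le> B"
    "\<And>x. continuous_on UNIV (f x)" "\<And>x t. f x (t + P) = f x t"
    by (elim lipschitz_coefficientE) blast
  from assms(2) obtain L' B' where g: "\<And>x y t. \<bar>g x t - g y t\<bar> \<le> L' * \<bar>x - y\<bar>"
    "\<And>x t. \<bar>g x t\<bar> \<le> B'"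
    "\<And>x. continuous_on UNIV (g x)" "\<And>x t. g x (t + P) = g x t"
    by (elim lipschitz_coefficientE) blast
  show ?thesis
  proof (rule lipschitz_coefficientI[of _ "L + L'" "B + B'"])
    fix x y t
    show "\<bar>f x t + g x t - (f y t + g y t)\<bar> \<le> (L + L') * \<bar>x - y\<bar>"
      using f(1)[of x t y] g(1)[of x t y] unfolding distrib_right by linarith
    show "\<bar>f x t + g x t\<bar> \<le> B + B'" using f(2)[of x t] g(2)[of x t] by linarith
  qed (use f(3,4) g(3,4) in \<open>auto intro: continuous_on_add\<close>)
qed

lemma lipschitz_coefficient_mult:
  assumes "lipschitz_coefficient P f" "lipschitz_coefficient P g"
  shows "lipschitz_coefficient P (\<lambda>x t. f x t * g x t)"
proof -
  from assms(1) obtain L B where f: "L \<ge> 0" "B \<ge> 0" "\<And>x y t. \<bar>f x t - f y t\<bar> \<le> L * \<bar>x - y\<bar>"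
    "\<And>x t. \<bar>f x t\<bar> \<le> B" "\<And>x. continuous_on UNIV (f x)" "\<And>x t. f x (t + P) = f x t"
    by (elim lipschitz_coefficientE) blast
  from assms(2) obtain L' B' where g: "L' \<ge> 0" "B' \<ge> 0" "\<And>x y t. \<bar>g x t - g y t\<bar> \<le> L' * \<bar>x - y\<bar>"
    "\<And>x t. \<bar>g x t\<bar> \<le> B'" "\<And>x. continuous_on UNIV (g x)" "\<And>x t. g x (t + P) = g x t"
    by (elim lipschitz_coefficientE) blast
  show ?thesis
  proof (rule lipschitz_coefficientI[of _ "B * L' + B' * L" "B * B'"])
    fix x y t
    have "f x t * g x t - f y t * g y t = f x t * (g x t - g y t) + g y t * (f x t - f y t)"
      by (simp add: algebra_simps)
    moreover have "\<bar>f x t * (g x t - g y t)\<bar> \<le> B * (L' * \<bar>x - y\<bar>)"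
      unfolding abs_mult using f g by (intro mult_mono) auto
    moreover have "\<bar>g y t * (f x t - f y t)\<bar> \<le> B' * (L * \<bar>x - y\<bar>)"
      unfolding abs_mult using f g by (intro mult_mono) auto
    ultimately show "\<bar>f x t * g x t - f y t * g y t\<bar> \<le> (B * L' + B' * L) * \<bar>x - y\<bar>"
      by (simp add: distrib_right)
    show "\<bar>f x t * g x t\<bar> \<le> B * B'"
      unfolding abs_mult using f g by (intro mult_mono) auto
  qed (use f g in \<open>auto intro: continuous_on_mult\<close>)
qed

lemma lipschitz_coefficient_inverse:
  assumes "lipschitz_coefficient P f" and "\<delta> > 0" and ge: "\<And>x t. \<delta> \<le> f x t"
  shows "lipschitz_coefficient P (\<lambda>x t. inverse (f x t))"
proof -
  from assms(1) obtain L B where f: "L \<ge> 0" "B \<ge> 0" "\<And>x y t. \<bar>f x t - f y t\<bar> \<le> L * \<bar>x - y\<bar>"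
    "\<And>x t. \<bar>f x t\<bar> \<le> B" "\<And>x. continuous_on UNIV (f x)" "\<And>x t. f x (t + P) = f x t"
    by (elim lipschitz_coefficientE) blast
  have pos: "f x t > 0" for x t using ge[of x t] \<open>\<delta> > 0\<close> by linarith
  have inv: "\<bar>inverse (f x t)\<bar> \<le> inverse \<delta>" for x t
    using ge[of x t] \<open>\<delta> > 0\<close> pos[of x t] le_imp_inverse_le[of \<delta> "f x t"] by simp
  show ?thesis
  proof (rule lipschitz_coefficientI[of _ "inverse \<delta> * inverse \<delta> * L" "inverse \<delta>"])
    fix x y t
    have "inverse (f x t) - inverse (f y t) = inverse (f x t) * inverse (f y t) * (f y t - f x t)"
      using pos[of x t] pos[of y t] by (simp add: field_simps)
    also have "\<bar>\<dots>\<bar> \<le> (inverse \<delta> * inverse \<delta>) * (L * \<bar>x - y\<bar>)"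
      unfolding abs_mult[of "_ * _"] abs_mult[of "inverse _"]
      using inv f(3)[of y t x] \<open>\<delta> > 0\<close> by (intro mult_mono) (auto simp: abs_minus_commute)
    finally show "\<bar>inverse (f x t) - inverse (f y t)\<bar> \<le> inverse \<delta> * inverse \<delta> * L * \<bar>x - y\<bar>"
      by (simp add: mult.assoc)
  next
    show "continuous_on UNIV (\<lambda>t. inverse (f x t))" for x
      by (intro continuous_on_inverse f(5)) (use pos in \<open>auto simp: less_imp_neq[THEN not_sym]\<close>)
  qed (use inv f(6) in auto)
qed

lemma lipschitz_coefficient_min:
  assumes "lipschitz_coefficient P f"
  shows "lipschitz_coefficient P (\<lambda>x t. f (min x M) t)"
proof -
  from assms(1) obtain L B where f: "L \<ge> 0" "\<And>x y t. \<bar>f x t - f y t\<bar> \<le> L * \<bar>x - y\<bar>"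
    "\<And>x t. \<bar>f x t\<bar> \<le> B" "\<And>x. continuous_on UNIV (f x)" "\<And>x t. f x (t + P) = f x t"
    by (elim lipschitz_coefficientE) blast
  show ?thesis
  proof (rule lipschitz_coefficientI[of _ L B])
    fix x y t
    have "L * \<bar>min x M - min y M\<bar> \<le> L * \<bar>x - y\<bar>" using f(1) by (intro mult_left_mono) auto
    with f(2) show "\<bar>f (min x M) t - f (min y M) t\<bar> \<le> L * \<bar>x - y\<bar>" by (rule order_trans)
  qed (use f in auto)
qed

text \<open>The field is given in generalised polar coordinates \<open>c \<rho> \<theta>\<close>, where it reads
  \<open>\<rho>' = p\<close>, \<open>\<theta>' = q\<close>. Since \<open>q > 0\<close>, orbits solve the scalar periodic equation \<open>d\<rho>/d\<theta> = p / q\<close>;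
  the truncation at \<open>M\<close> makes \<open>1 / q\<close> bounded and is not felt by solutions below \<open>M\<close>.\<close>

theorem limit_cycle_polar:
  fixes F :: "real^'n \<Rightarrow> real^'n" and c :: "real \<Rightarrow> real \<Rightarrow> real^'n"
  assumes "P > 0" and p: "lipschitz_coefficient P p" and q: "lipschitz_coefficient P q"
    and "\<delta> > 0" and q_ge: "\<And>\<rho> \<theta>. \<rho> \<le> M \<Longrightarrow> \<delta> \<le> q \<rho> \<theta>"
    and low: "\<And>\<rho> \<theta>. \<rho> \<le> m \<Longrightarrow> 0 < p \<rho> \<theta>" and "m < M" and high: "\<And>\<theta>. p M \<theta> < 0"
    and c_cont: "continuous_on UNIV (\<lambda>(\<rho>, \<theta>). c \<rho> \<theta>)" and c_per: "\<And>\<rho> \<theta>. c \<rho> (\<theta> + P) = c \<rho> \<theta>"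
    and c_inj: "\<And>\<rho> \<theta> \<rho>' \<theta>'. c \<rho> \<theta> = c \<rho>' \<theta>' \<Longrightarrow> \<rho> = \<rho>' \<and> (\<exists>k::int. \<theta> = \<theta>' + of_int k * P)"
    and c_field: "\<And>\<rho> \<theta> t. (\<rho> has_real_derivative p (\<rho> t) (\<theta> t)) (at t) \<Longrightarrow>
      (\<theta> has_real_derivative q (\<rho> t) (\<theta> t)) (at t) \<Longrightarrow>
      ((\<lambda>t. c (\<rho> t) (\<theta> t)) has_vector_derivative F (c (\<rho> t) (\<theta> t))) (at t)"
  shows "\<exists>x. is_limit_cycle F x \<and> (\<forall>t. \<exists>\<rho> \<theta>. x t = c \<rho> \<theta>)"
proof -
  define f where "f = (\<lambda>\<rho> \<theta>. p (min \<rho> M) \<theta> * inverse (q (min \<rho> M) \<theta>))"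
  have qM: "\<delta> \<le> q (min \<rho> M) \<theta>" for \<rho> \<theta> by (rule q_ge) simp
  then have qM_pos: "0 < q (min \<rho> M) \<theta>" for \<rho> \<theta> using \<open>\<delta> > 0\<close> by (rule less_le_trans[rotated])
  have "lipschitz_coefficient P f"
    unfolding f_def
    by (intro lipschitz_coefficient_mult lipschitz_coefficient_inverse[OF _ \<open>\<delta> > 0\<close>]
        lipschitz_coefficient_min p q qM)
  then obtain L B where f: "\<And>x y t. \<bar>f x t - f y t\<bar> \<le> L * \<bar>x - y\<bar>"
    "\<And>x t. \<bar>f x t\<bar> \<le> B" "\<And>x. continuous_on UNIV (f x)" "\<And>x t. f x (t + P) = f x t"
    by (elim lipschitz_coefficientE) blast
  have f_low: "0 < f \<rho> \<theta>" if "\<rho> \<le> m" for \<rho> \<theta>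
    unfolding f_def using that qM_pos[of \<rho> \<theta>] by (intro mult_pos_pos low) auto
  have f_high: "f \<rho> \<theta> < 0" if "M \<le> \<rho>" for \<rho> \<theta>
    unfolding f_def using that high qM_pos[of \<rho> \<theta>] by (intro mult_neg_pos) (auto simp: min_def)
  obtain \<phi> \<psi> where
    \<phi>: "\<And>s. (\<phi> has_real_derivative f (\<phi> s) s) (at s)" and
    \<psi>: "\<And>s. (\<psi> has_real_derivative f (\<psi> s) s) (at s)" and
    \<phi>_per: "\<And>s. \<phi> (s + P) = \<phi> s" and \<psi>\<phi>: "\<And>s. \<psi> s < \<phi> s" and \<phi>M: "\<And>s. \<phi> s < M" and
    conv: "((\<lambda>s. \<phi> s - \<psi> s) \<longlongrightarrow> 0) at_top"
    by (rule periodic_ode_connection[where m = m and M = M, OF f(1,3,2) \<open>P > 0\<close> f(4)])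
      (rule f_low f_high that, assumption+)+
  obtain Lq Bq where q': "\<And>x y t. \<bar>q x t - q y t\<bar> \<le> Lq * \<bar>x - y\<bar>" "\<And>x t. \<bar>q x t\<bar> \<le> Bq"
    "\<And>x. continuous_on UNIV (q x)" "\<And>x t. q x (t + P) = q x t"
    using q by (elim lipschitz_coefficientE) blast
  \<comment> \<open>Back from angle to time: below M the truncation is inactive, so f q = p and the
    chain rule returns the polar system.\<close>
  have traj: "\<exists>\<Theta> \<tau>. (\<forall>s. \<Theta> (\<tau> s) = s) \<and> (\<forall>t. \<tau> (\<Theta> t) = t) \<and> strict_mono \<tau> \<and>
      filterlim \<Theta> at_top at_top \<and> filterlim \<tau> at_top at_top \<and>
      (\<forall>s. (\<tau> has_real_derivative 1 / q (r s) s) (at s)) \<and>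
      is_trajectory F (\<lambda>t. c (r (\<Theta> t)) (\<Theta> t))"
    if r: "\<And>s. (r has_real_derivative f (r s) s) (at s)" and rM: "\<And>s. r s < M" for r
  proof -
    have "continuous_on UNIV r" using r DERIV_isCont continuous_at_imp_continuous_on by blast
    then have qc: "continuous_on UNIV (\<lambda>s. q (r s) s)"
      by (rule continuous_on_lipschitz_comp[OF q'(1,3)])
    have ge: "\<delta> \<le> q (r s) s" for s using rM[of s] by (intro q_ge) simp
    have le: "q (r s) s \<le> Bq" for s using q'(2)[of "r s" s] by simp
    obtain \<Theta> \<tau> where \<Theta>: "\<And>s. \<Theta> (\<tau> s) = s" "\<And>t. \<tau> (\<Theta> t) = t"
      "\<And>t. (\<Theta> has_real_derivative q (r (\<Theta> t)) (\<Theta> t)) (at t)"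
      "\<And>s. (\<tau> has_real_derivative 1 / q (r s) s) (at s)"
      "strict_mono \<tau>" "filterlim \<Theta> at_top at_top" "filterlim \<tau> at_top at_top"
      by (rule autonomous_time_change[OF qc \<open>\<delta> > 0\<close> ge le]) (rule that)
    have "((\<lambda>t. r (\<Theta> t)) has_real_derivative p (r (\<Theta> t)) (\<Theta> t)) (at t)" for t
    proof -
      have "f (r (\<Theta> t)) (\<Theta> t) * q (r (\<Theta> t)) (\<Theta> t) = p (r (\<Theta> t)) (\<Theta> t)"
        using rM[of "\<Theta> t"] qM_pos[of "r (\<Theta> t)" "\<Theta> t"] by (simp add: f_def min_def)
      then show ?thesis using DERIV_chain2[OF r \<Theta>(3), of t] by simp
    qed
    then have "is_trajectory F (\<lambda>t. c (r (\<Theta> t)) (\<Theta> t))"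
      unfolding is_trajectory_def using c_field[of "\<lambda>t. r (\<Theta> t)" _ \<Theta>] \<Theta>(3) by blast
    with \<Theta> show ?thesis by blast
  qed
  obtain \<Theta> \<tau> where \<Theta>: "\<And>s. \<Theta> (\<tau> s) = s" "\<And>t. \<tau> (\<Theta> t) = t" "strict_mono \<tau>"
      and \<tau>': "\<And>s. (\<tau> has_real_derivative 1 / q (\<phi> s) s) (at s)"
      and xtraj: "is_trajectory F (\<lambda>t. c (\<phi> (\<Theta> t)) (\<Theta> t))"
    using traj[OF \<phi> \<phi>M] by blast
  obtain H \<sigma> where H: "\<And>s. H (\<sigma> s) = s" "filterlim H at_top at_top" "filterlim \<sigma> at_top at_top"
      and ytraj: "is_trajectory F (\<lambda>t. c (\<psi> (H t)) (H t))"
    using traj[OF \<psi> less_trans[OF \<psi>\<phi> \<phi>M]] by blast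
  define C where "C = (\<lambda>s. c (\<phi> s) s)"
  define x where "x = (\<lambda>t. C (\<Theta> t))"
  define y where "y = (\<lambda>t. c (\<psi> (H t)) (H t))"
  have range_x: "range x = range C"
  proof -
    have "range \<Theta> = UNIV" using \<Theta>(1) by (rule surjI)
    then have "C ` range \<Theta> = range C" by simp
    then show ?thesis by (simp add: x_def image_image)
  qed
  have c_per': "c \<rho> (\<theta> - of_int k * P) = c \<rho> \<theta>" "c \<rho> (\<theta> + of_int k * P) = c \<rho> \<theta>" for \<rho> \<theta> k
    by (intro periodic_of_int c_per)+
  have \<phi>_per': "\<phi> (\<theta> - of_int k * P) = \<phi> \<theta>" "\<phi> (\<theta> + of_int k * P) = \<phi> \<theta>" for \<theta> k
    by (intro periodic_of_int \<phi>_per)+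
  have c_lim: "((\<lambda>i. c (u i) (v i)) \<longlongrightarrow> c a b) G" if "(u \<longlongrightarrow> a) G" "(v \<longlongrightarrow> b) G" for u v a b and G :: "nat filter"
    using continuous_on_tendsto_compose[OF c_cont tendsto_Pair[OF that]] by simp
  have \<phi>_cont: "continuous_on S \<phi>" for S
    using \<phi> DERIV_isCont continuous_at_imp_continuous_on by blast
  have nonconst: "\<exists>s t. x s \<noteq> x t"
  proof -
    have "C 0 \<noteq> C (P / 2)"
    proof
      assume "C 0 = C (P / 2)"
      \<comment> \<open>Half a turn is not a whole number of turns; the contradiction is the parity
        of 1 + 2 k.\<close>
      then obtain k :: int where "0 = P / 2 + of_int k * P" unfolding C_def using c_inj by blast
      then have "P * (1 + 2 * of_int k) = 0" by (simp add: algebra_simps)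
      then have "1 + 2 * of_int k = (0::real)" using \<open>P > 0\<close> by simp
      then have "1 + 2 * k = 0" by (metis of_int_1 of_int_add of_int_eq_0_iff of_int_mult of_int_numeral)
      then show False by presburger
    qed
    then have "x (\<tau> 0) \<noteq> x (\<tau> (P / 2))" by (simp add: x_def \<Theta>(1))
    then show ?thesis by blast
  qed
  have period: "\<exists>T>0. \<forall>t. x (t + T) = x t"
  proof -
    define T where "T = \<tau> P - \<tau> 0"
    \<comment> \<open>\<phi> and q repeat after a turn, so every turn takes the same time T,
      whatever the starting angle.\<close>
    have "((\<lambda>s. \<tau> (s + P) - \<tau> s) has_real_derivative 0) (at s)" for s
      using DERIV_diff[OF _ \<tau>'[of s], of "\<lambda>s. \<tau> (s + P)" "1 / q (\<phi> s) s"] \<tau>'[of "s + P"]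
      by (simp add: DERIV_shift \<phi>_per q'(4))
    then have \<tau>P: "\<tau> (s + P) - \<tau> s = T" for s
      using DERIV_isconst_all[of "\<lambda>s. \<tau> (s + P) - \<tau> s" s 0] by (simp add: T_def)
    have "\<Theta> (t + T) = \<Theta> t + P" for t
    proof -
      have "\<tau> (\<Theta> t + P) = t + T" using \<tau>P[of "\<Theta> t"] \<Theta>(2)[of t] by simp
      then show ?thesis using \<Theta>(1)[of "\<Theta> t + P"] by simp
    qed
    then have "x (t + T) = x t" for t by (simp add: x_def C_def \<phi>_per c_per)
    moreover have "T > 0" using strict_monoD[OF \<Theta>(3), of 0 P] \<open>P > 0\<close> by (simp add: T_def)
    ultimately show ?thesis by blast
  qed
  have off: "\<not> range y \<subseteq> range x"
  proof
    assume "range y \<subseteq> range x"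
    then obtain s where "y 0 = C s" unfolding range_x by blast
    then have "\<psi> (H 0) = \<phi> s" "\<exists>k::int. H 0 = s + of_int k * P"
      unfolding y_def C_def using c_inj by blast+
    then show False using \<psi>\<phi>[of "H 0"] \<phi>_per'(2) by auto
  qed
  have "omega_limit_set y = range x"
  proof (intro equalityI subsetI)
    fix z assume "z \<in> omega_limit_set y"
    then obtain s where s: "filterlim s at_top sequentially" "(\<lambda>n. y (s n)) \<longlonglongrightarrow> z"
      unfolding omega_limit_set_def by blast
    \<comment> \<open>Angles tend to infinity, but the point only depends on them modulo P. Reduced
      angles have a convergent subsequence, and \<open>conv\<close> allows \<psi> to be replaced by
      \<phi> in the limit.\<close>
    have "\<exists>k::int. H (s n) - of_int k * P \<in> {0..P}" for n
      by (rule periodic_reduce[OF \<open>P > 0\<close>, of "H (s n)"]) auto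
    then obtain k :: "nat \<Rightarrow> int" where k: "\<And>n. H (s n) - of_int (k n) * P \<in> {0..P}" by metis
    define \<theta> where "\<theta> = (\<lambda>n. H (s n) - of_int (k n) * P)"
    have "\<forall>n. \<theta> n \<in> {0..P}" using k by (simp only: \<theta>_def) simp
    then obtain b \<iota> where \<iota>: "strict_mono \<iota>" and b: "(\<theta> \<circ> \<iota>) \<longlonglongrightarrow> b"
      using compact_Icc[of 0 P] unfolding compact_def by meson
    have Hs: "filterlim (\<lambda>n. H (s (\<iota> n))) at_top sequentially"
      by (intro filterlim_compose[OF H(2)] filterlim_compose[OF s(1)] filterlim_subseq[OF \<iota>])
    have "(\<lambda>n. \<phi> ((\<theta> \<circ> \<iota>) n)) \<longlonglongrightarrow> \<phi> b"
      using continuous_on_tendsto_compose[OF \<phi>_cont[of UNIV] b] by simp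
    then have "(\<lambda>n. \<phi> ((\<theta> \<circ> \<iota>) n) - (\<phi> (H (s (\<iota> n))) - \<psi> (H (s (\<iota> n))))) \<longlonglongrightarrow> \<phi> b - 0"
      by (intro tendsto_diff filterlim_compose[OF conv Hs])
    then have "(\<lambda>n. \<psi> (H (s (\<iota> n)))) \<longlonglongrightarrow> \<phi> b" by (simp add: \<theta>_def \<phi>_per')
    from c_lim[OF this b] have "(\<lambda>n. y (s (\<iota> n))) \<longlonglongrightarrow> C b"
      by (simp add: \<theta>_def c_per' y_def C_def)
    moreover have "(\<lambda>n. y (s (\<iota> n))) \<longlonglongrightarrow> z"
      using LIMSEQ_subseq_LIMSEQ[OF s(2) \<iota>] by (simp add: o_def)
    ultimately have "z = C b" by (rule LIMSEQ_unique[rotated])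
    then show "z \<in> range x" unfolding range_x by blast
  next
    fix z assume "z \<in> range x"
    then obtain b where b: "z = C b" unfolding range_x by blast
    \<comment> \<open>Successive passages through the ray of angle b; they occur at the times
      \<open>\<sigma> (s n)\<close>.\<close>
    define s where "s = (\<lambda>n. b + real n * P)"
    have s: "filterlim s at_top sequentially"
      unfolding s_def
      by (intro filterlim_tendsto_add_at_top[OF tendsto_const]
          filterlim_at_top_mult_tendsto_pos[OF tendsto_const \<open>P > 0\<close>] filterlim_real_sequentially)
    have per: "\<phi> (s n) = \<phi> b" "c r (s n) = c r b" for n r
      using \<phi>_per'(2)[of b "int n"] c_per'(2)[of r b "int n"] by (simp_all add: s_def)
    have "(\<lambda>n. \<phi> b - (\<phi> (s n) - \<psi> (s n))) \<longlonglongrightarrow> \<phi> b - 0"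
      by (intro tendsto_diff filterlim_compose[OF conv s] tendsto_const)
    then have "(\<lambda>n. \<psi> (s n)) \<longlonglongrightarrow> \<phi> b" by (simp add: per)
    from c_lim[OF this tendsto_const[of b]] have "(\<lambda>n. y (\<sigma> (s n))) \<longlonglongrightarrow> z"
      by (simp add: y_def H(1) per b C_def)
    moreover have "filterlim (\<lambda>n. \<sigma> (s n)) at_top sequentially"
      by (rule filterlim_compose[OF H(3) s])
    ultimately show "z \<in> omega_limit_set y" unfolding omega_limit_set_def by blast
  qed
  moreover have "is_trajectory F x" "is_trajectory F y"
    using xtraj ytraj by (simp_all add: x_def y_def C_def)
  ultimately have "is_limit_cycle F x"
    unfolding is_limit_cycle_def using nonconst period off by blast
  moreover have "\<forall>t. \<exists>\<rho> \<theta>. x t = c \<rho> \<theta>" by (auto simp: x_def C_def)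
  ultimately show ?thesis by blast
qed

section \<open>Bounds for the hyperbolic tangent\<close>

lemma tanh_real_le_self: "0 \<le> s \<Longrightarrow> tanh s \<le> (s::real)"
proof -
  assume "0 \<le> s"
  have "0 - tanh 0 \<le> s - tanh s"
  proof (rule DERIV_nonneg_imp_nondecreasing[OF \<open>0 \<le> s\<close>])
    fix u :: real
    have "((\<lambda>s. s - tanh s) has_real_derivative (tanh u)\<^sup>2) (at u)"
      by (auto intro!: derivative_eq_intros)
    then show "\<exists>d. ((\<lambda>s. s - tanh s) has_real_derivative d) (at u) \<and> 0 \<le> d" by force
  qed
  then show ?thesis by simp
qed

text \<open>In terms of e = exp (-2 s) this is (1 + 2 s) e <= 1, that is, exp (2 s) >= 1 + 2
  s.\<close>

lemma tanh_real_ge: "0 \<le> s \<Longrightarrow> s / (1 + s) \<le> tanh (s::real)"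
proof -
  assume s: "0 \<le> s"
  define e where "e = exp (- 2 * s)"
  have "(1 + 2 * s) * e \<le> exp (2 * s) * e"
    using exp_ge_add_one_self[of "2 * s"] by (intro mult_right_mono) (auto simp: e_def)
  also have "\<dots> = 1" by (simp add: e_def flip: exp_add)
  finally have "s * (1 + e) \<le> (1 - e) * (1 + s)" by (simp add: algebra_simps)
  moreover have "e > 0" by (simp add: e_def)
  ultimately have "s / (1 + s) \<le> (1 - e) / (1 + e)"
    using s by (simp add: pos_divide_le_eq pos_le_divide_eq)
  then show ?thesis by (simp add: tanh_real_altdef e_def)
qed

lemma abs_tanh_le: "\<bar>tanh s\<bar> \<le> \<bar>s::real\<bar>"
  using tanh_real_le_self[of "\<bar>s\<bar>"] by simp

lemma tanh_mult_self_ge: "s\<^sup>2 / (1 + \<bar>s\<bar>) \<le> s * tanh (s::real)"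
proof -
  have "\<bar>s\<bar> * (\<bar>s\<bar> / (1 + \<bar>s\<bar>)) \<le> \<bar>s\<bar> * tanh \<bar>s\<bar>"
    by (intro mult_left_mono tanh_real_ge) auto
  moreover have "\<bar>s\<bar> * tanh \<bar>s\<bar> = s * tanh s" by (cases "s \<ge> 0") auto
  ultimately show ?thesis by (simp add: power2_eq_square flip: abs_mult)
qed

text \<open>A quadratic error is enough: after rescaling by \<open>exp (- \<rho>)\<close> an error
  of order \<open>exp \<rho>\<close> is left, which vanishes at the origin.\<close>

lemma abs_tanh_diff_self_le: "\<bar>tanh s - s\<bar> \<le> (s::real)\<^sup>2"
proof -
  define r where "r = \<bar>s\<bar>"
  have r: "0 \<le> r" by (simp add: r_def)
  have "(r - r\<^sup>2) * (1 + r) \<le> r"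
    using r by (simp add: algebra_simps power2_eq_square)
  then have "r - r\<^sup>2 \<le> r / (1 + r)" using r by (simp add: pos_le_divide_eq del: diff_le_eq)
  then have "\<bar>tanh r - r\<bar> \<le> r\<^sup>2"
    using tanh_real_ge[OF r] tanh_real_le_self[OF r] by linarith
  moreover have "\<bar>tanh r - r\<bar> = \<bar>tanh s - s\<bar>" by (cases "s \<ge> 0") (auto simp: r_def)
  ultimately show ?thesis by (simp add: r_def)
qed

text \<open>The factor \<open>exp (- x)\<close> blows up towards the origin, but |tanh s| <= |s|
  compensates it. The derivative in x is g h (1 - tanh^2) minus the function itself; each term is at
  most |g| B, hence the constant 2 |g| B.\<close>

lemma lipschitz_coefficient_tanh:
  assumes h: "continuous_on UNIV h" "\<And>t. \<bar>h t\<bar> \<le> B" "\<And>t. h (t + P) = h t"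
  shows "lipschitz_coefficient P (\<lambda>x t. exp (- x) * tanh (g * (exp x * h t)))"
proof -
  have bd: "\<bar>exp (- x) * tanh (g * (exp x * h t))\<bar> \<le> \<bar>g\<bar> * B" for x t
  proof -
    have "\<bar>exp (- x) * tanh (g * (exp x * h t))\<bar> \<le> exp (- x) * \<bar>g * (exp x * h t)\<bar>"
      unfolding abs_mult[of "exp _"] using abs_tanh_le by (intro mult_mono) auto
    also have "\<dots> = \<bar>g\<bar> * \<bar>h t\<bar>" by (simp add: abs_mult exp_minus field_simps)
    also have "\<dots> \<le> \<bar>g\<bar> * B" using h(2) by (intro mult_left_mono) auto
    finally show ?thesis .
  qed
  show ?thesis
  proof (rule lipschitz_coefficientI[of _ "2 * \<bar>g\<bar> * B" "\<bar>g\<bar> * B"])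
    fix x y t
    define k where "k = (\<lambda>x. exp (- x) * tanh (g * (exp x * h t)))"
    have "(k has_real_derivative g * h t * (1 - (tanh (g * (exp x * h t)))\<^sup>2) - k x) (at x)" for x
      unfolding k_def by (auto intro!: derivative_eq_intros simp: exp_minus field_simps)
    moreover have "norm (g * h t * (1 - (tanh (g * (exp x * h t)))\<^sup>2) - k x) \<le> 2 * \<bar>g\<bar> * B" for x
    proof -
      have "(tanh (g * (exp x * h t)))\<^sup>2 \<le> 1"
        using tanh_real_bounds[of "g * (exp x * h t)"] by (auto simp: abs_square_le_1)
      then have "\<bar>g * h t * (1 - (tanh (g * (exp x * h t)))\<^sup>2)\<bar> \<le> (\<bar>g\<bar> * B) * 1"
        unfolding abs_mult[of "g * h t"]
        using h(2)[of t] abs_mult[of g "h t"] mult_left_mono[OF h(2)[of t], of "\<bar>g\<bar>"]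
        by (intro mult_mono) auto
      then show ?thesis using bd[of x t] unfolding k_def real_norm_def by linarith
    qed
    ultimately have "norm (k x - k y) \<le> 2 * \<bar>g\<bar> * B * norm (x - y)"
      by (intro field_differentiable_bound[of UNIV k]) auto
    then show "\<bar>exp (- x) * tanh (g * (exp x * h t)) - exp (- y) * tanh (g * (exp y * h t))\<bar>
        \<le> 2 * \<bar>g\<bar> * B * \<bar>x - y\<bar>" by (simp add: k_def)
  qed (auto intro!: continuous_intros h(1) bd[simplified] simp: h(3))
qed

text \<open>The right side is, up to a positive factor, the angular speed at (x, y); the leak is
  radial and drops out. If x and y have opposite signs, the cross terms help. Otherwise n - \<alpha>
  <= n - 1 makes their weights equal, and monotonicity of \<open>tanh\<close> gives the
  rearrangement inequality (x - y)(s - t) >= 0.\<close>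

lemma rotation_form_ge:
  fixes x y :: real
  assumes "1 < \<alpha>" "\<alpha> \<le> n" "0 < g"
  shows "x * tanh (g * x) + y * tanh (g * y) \<le>
    x * (n * tanh (g * x) - (n - \<alpha>) * tanh (g * y)) - y * ((n - 1) * tanh (g * x) - n * tanh (g * y))"
proof -
  define s t where "s = tanh (g * x)" and "t = tanh (g * y)"
  have sgn: "s \<ge> 0 \<longleftrightarrow> x \<ge> 0" "s \<le> 0 \<longleftrightarrow> x \<le> 0" "t \<ge> 0 \<longleftrightarrow> y \<ge> 0" "t \<le> 0 \<longleftrightarrow> y \<le> 0"
    using \<open>0 < g\<close> by (auto simp: s_def t_def zero_le_mult_iff mult_le_0_iff)
  have xs: "x * s \<ge> 0" "y * t \<ge> 0" using sgn by (auto simp: zero_le_mult_iff)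
  have "(n - \<alpha>) * (x * t) + (n - 1) * (y * s) \<le> (n - 1) * (x * s + y * t)"
  proof (cases "x * y \<le> 0")
    case True
    then have "x * t \<le> 0" "y * s \<le> 0" using sgn by (auto simp: mult_le_0_iff)
    then have "(n - \<alpha>) * (x * t) \<le> 0" "(n - 1) * (y * s) \<le> 0" "0 \<le> (n - 1) * (x * s + y * t)"
      using assms xs by (auto intro: mult_nonneg_nonpos)
    then show ?thesis by linarith
  next
    case False
    then have "x * t \<ge> 0" using sgn by (auto simp: zero_le_mult_iff mult_le_0_iff)
    then have "(n - \<alpha>) * (x * t) \<le> (n - 1) * (x * t)" using assms by (intro mult_right_mono) auto
    moreover have "0 \<le> (x - y) * (s - t)"
      using \<open>0 < g\<close> by (cases "x \<le> y") (auto simp: s_def t_def zero_le_mult_iff)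
    then have "(n - 1) * (x * t + y * s) \<le> (n - 1) * (x * s + y * t)"
      using assms by (intro mult_left_mono) (auto simp: algebra_simps)
    ultimately show ?thesis by (simp add: distrib_left)
  qed
  then show ?thesis unfolding s_def[symmetric] t_def[symmetric] by (simp add: algebra_simps)
qed

section \<open>States with two activity levels\<close>

definition two_level :: "real \<Rightarrow> real \<Rightarrow> real^('e::finite + 'i::finite)"
  where "two_level u v = (\<chi> i. case i of Inl _ \<Rightarrow> u | Inr _ \<Rightarrow> v)"

lemma two_level_nth [simp]: "two_level u v $ Inl a = u" "two_level u v $ Inr b = v"
  by (simp_all add: two_level_def)

lemma two_level_eq_iff: "two_level u v = two_level u' v' \<longleftrightarrow> u = u' \<and> v = v'"
  by (metis two_level_nth)

lemma two_level_linear: "two_level u v = u *\<^sub>R two_level 1 0 + v *\<^sub>R two_level 0 1"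
  by (auto simp: vec_eq_iff two_level_def split: sum.split)

lemma two_level_has_vector_derivative:
  assumes "(u has_real_derivative u') (at t)" "(v has_real_derivative v') (at t)"
  shows "((\<lambda>t. two_level (u t) (v t)) has_vector_derivative two_level u' v') (at t)"
proof -
  have "((\<lambda>t. u t *\<^sub>R two_level 1 0 + v t *\<^sub>R two_level 0 1) has_vector_derivative
      u' *\<^sub>R two_level 1 0 + v' *\<^sub>R two_level 0 1) (at t)"
    using assms by (auto intro!: derivative_eq_intros)
  then show ?thesis by (simp flip: two_level_linear)
qed

lemma sum_UNIV_sum:
  "(\<Sum>j\<in>(UNIV :: ('e::finite + 'i::finite) set). h j) = (\<Sum>a\<in>UNIV. h (Inl a)) + (\<Sum>b\<in>UNIV. h (Inr b))"
  by (simp add: sum.Plus flip: UNIV_Plus_UNIV)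

lemma K_mat_row_sum:
  "(\<Sum>b\<in>UNIV. (K_mat :: real^'n^'n) $ a $ b * (s::real)) = (real CARD('n) - 1) * s"
proof -
  have "(\<Sum>b\<in>UNIV. (K_mat :: real^'n^'n) $ a $ b * s) = (\<Sum>b\<in>UNIV. s - (if a = b then s else 0))"
    by (intro sum.cong) (auto simp: K_mat_def ones_mat_def mat_def)
  then show ?thesis by (simp add: sum_subtractf algebra_simps)
qed

text \<open>Only row sums matter on the synchronous plane, and balance expresses them through n and
  \<alpha>: an excitatory cell receives inhibitory weight \<alpha> n_I = n, an inhibitory one
  \<alpha> (n_I - 1) = n - \<alpha>.\<close>

lemma network_field_two_level:
  fixes \<alpha> \<mu> g u v :: real
  defines "c \<equiv> \<mu> / sqrt (real CARD('e + 'i))" and "n \<equiv> real CARD('e)"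
  assumes n: "n = \<alpha> * real CARD('i)"
  shows "network_field \<alpha> \<mu> g (two_level u v :: real^('e::finite + 'i::finite)) =
    two_level (- u + c * ((n - 1) * tanh (g * u) - n * tanh (g * v)))
      (- v + c * (n * tanh (g * u) - (n - \<alpha>) * tanh (g * v)))"
proof -
  have t: "tanh_vec (g *\<^sub>R two_level u v) = (two_level (tanh (g * u)) (tanh (g * v)) :: real^('e + 'i))"
    by (auto simp: tanh_vec_def vec_eq_iff two_level_def split: sum.split)
  have H: "(H_mat \<alpha> \<mu> *v two_level s r) = (two_level (\<mu> * ((n - 1) * s - n * r)) (\<mu> * (n * s - (n - \<alpha>) * r)) :: real^('e + 'i))"
    for s r
  proof -
    have "(H_mat \<alpha> \<mu> *v two_level s r :: real^('e + 'i)) $ Inl a = \<mu> * ((n - 1) * s - n * r)" for a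
    proof -
      have "(H_mat \<alpha> \<mu> *v two_level s r :: real^('e + 'i)) $ Inl a =
          \<mu> * (\<Sum>b\<in>UNIV. (K_mat :: real^'e^'e) $ a $ b * s) - \<alpha> * \<mu> * (real CARD('i) * r)"
        by (simp add: matrix_vector_mult_def sum_UNIV_sum H_mat_def block_mat_def ones_mat_def
            sum_distrib_left mult.assoc sum_negf)
      then show ?thesis unfolding K_mat_row_sum using n by (simp add: n_def algebra_simps)
    qed
    moreover have "(H_mat \<alpha> \<mu> *v two_level s r :: real^('e + 'i)) $ Inr a = \<mu> * (n * s - (n - \<alpha>) * r)" for a
    proof -
      have "(H_mat \<alpha> \<mu> *v two_level s r :: real^('e + 'i)) $ Inr a =
          \<mu> * (n * s) - \<alpha> * \<mu> * (\<Sum>b\<in>UNIV. (K_mat :: real^'i^'i) $ a $ b * r)"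
        by (simp add: matrix_vector_mult_def sum_UNIV_sum H_mat_def block_mat_def ones_mat_def
            sum_distrib_left mult.assoc sum_negf n_def)
      then show ?thesis unfolding K_mat_row_sum using n by (simp add: algebra_simps)
    qed
    ultimately show ?thesis by (auto simp: vec_eq_iff two_level_def split: sum.split)
  qed
  show ?thesis
    unfolding network_field_def t H
    by (auto simp: vec_eq_iff two_level_def c_def split: sum.split)
qed

section \<open>The synchronous network\<close>

text \<open>Here n is the number of excitatory cells and c = \<mu> / sqrt N;
  \<open>\<alpha> \<le> n\<close> says that there is an inhibitory cell, and \<open>unstable\<close>
  is the condition g > g_H.\<close>

locale synchronous_network =
  fixes n \<alpha> c g :: real
  assumes \<alpha>: "1 < \<alpha>" and n: "\<alpha> \<le> n" and c: "0 < c" and g: "0 < g"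
    and unstable: "2 < c * g * (\<alpha> - 1)"
begin

text \<open>At the origin the linearisation has trace \<open>c g (\<alpha> - 1) - 2\<close> and complex eigenvalues. The
  coefficients make it conformal in the coordinates \<open>u = e\<^sup>\<rho> U \<theta>\<close>, \<open>v = e\<^sup>\<rho> W \<theta>\<close>: near
  the origin \<open>\<rho>'\<close> is half the trace, up to an error of order \<open>e\<^sup>\<rho>\<close>.\<close>

definition "k\<^sub>1 = sqrt (4 * n - 1 - \<alpha>)"
definition "k\<^sub>2 = sqrt (1 + \<alpha>)"
definition U :: "real \<Rightarrow> real" where "U \<theta> = k\<^sub>1 * sin \<theta> + k\<^sub>2 * cos \<theta>"
definition W :: "real \<Rightarrow> real" where "W \<theta> = k\<^sub>1 * sin \<theta> - k\<^sub>2 * cos \<theta>"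
definition U' :: "real \<Rightarrow> real" where "U' \<theta> = k\<^sub>1 * cos \<theta> - k\<^sub>2 * sin \<theta>"
definition W' :: "real \<Rightarrow> real" where "W' \<theta> = k\<^sub>1 * cos \<theta> + k\<^sub>2 * sin \<theta>"
text \<open>Cell outputs divided by the radius: they tend to g U and g W at the origin and decay
  like \<open>exp (- \<rho>)\<close> far out.\<close>

definition \<sigma> :: "real \<Rightarrow> real \<Rightarrow> real" where "\<sigma> \<rho> \<theta> = exp (- \<rho>) * tanh (g * (exp \<rho> * U \<theta>))"
definition \<tau> :: "real \<Rightarrow> real \<Rightarrow> real" where "\<tau> \<rho> \<theta> = exp (- \<rho>) * tanh (g * (exp \<rho> * W \<theta>))"
text \<open>The denominator is the determinant of the frame (U, W), (U', W'); p and q come from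
  Cramer's rule.\<close>

definition d where "d = c / (2 * k\<^sub>1 * k\<^sub>2)"
definition p :: "real \<Rightarrow> real \<Rightarrow> real" where "p \<rho> \<theta> = - 1 +
  d * (W' \<theta> * ((n - 1) * \<sigma> \<rho> \<theta> - n * \<tau> \<rho> \<theta>) - U' \<theta> * (n * \<sigma> \<rho> \<theta> - (n - \<alpha>) * \<tau> \<rho> \<theta>))"
definition q :: "real \<Rightarrow> real \<Rightarrow> real" where "q \<rho> \<theta> =
  d * (U \<theta> * (n * \<sigma> \<rho> \<theta> - (n - \<alpha>) * \<tau> \<rho> \<theta>) - W \<theta> * ((n - 1) * \<sigma> \<rho> \<theta> - n * \<tau> \<rho> \<theta>))"

lemma k_pos: "0 < k\<^sub>1" "0 < k\<^sub>2"
  using \<alpha> n by (simp_all add: k\<^sub>1_def k\<^sub>2_def)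

lemma k_squares: "k\<^sub>1\<^sup>2 = 4 * n - 1 - \<alpha>" "k\<^sub>2\<^sup>2 = 1 + \<alpha>"
  using \<alpha> n by (simp_all add: k\<^sub>1_def k\<^sub>2_def)

lemma d_pos: "0 < d"
  using k_pos c by (simp add: d_def)

lemma frame_bounds: "\<bar>U \<theta>\<bar> \<le> k\<^sub>1 + k\<^sub>2" "\<bar>W \<theta>\<bar> \<le> k\<^sub>1 + k\<^sub>2" "\<bar>U' \<theta>\<bar> \<le> k\<^sub>1 + k\<^sub>2" "\<bar>W' \<theta>\<bar> \<le> k\<^sub>1 + k\<^sub>2"
proof -
  have "\<bar>k\<^sub>1 * sin \<theta>\<bar> \<le> k\<^sub>1" "\<bar>k\<^sub>1 * cos \<theta>\<bar> \<le> k\<^sub>1" "\<bar>k\<^sub>2 * sin \<theta>\<bar> \<le> k\<^sub>2" "\<bar>k\<^sub>2 * cos \<theta>\<bar> \<le> k\<^sub>2"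
    using k_pos by (simp_all add: abs_mult mult_left_le)
  then show "\<bar>U \<theta>\<bar> \<le> k\<^sub>1 + k\<^sub>2" "\<bar>W \<theta>\<bar> \<le> k\<^sub>1 + k\<^sub>2" "\<bar>U' \<theta>\<bar> \<le> k\<^sub>1 + k\<^sub>2" "\<bar>W' \<theta>\<bar> \<le> k\<^sub>1 + k\<^sub>2"
    unfolding U_def W_def U'_def W'_def by linarith+
qed

lemma wronskian: "U \<theta> * W' \<theta> - W \<theta> * U' \<theta> = 2 * k\<^sub>1 * k\<^sub>2"
proof -
  have "U \<theta> * W' \<theta> - W \<theta> * U' \<theta> = 2 * k\<^sub>1 * k\<^sub>2 * ((sin \<theta>)\<^sup>2 + (cos \<theta>)\<^sup>2)"
    unfolding U_def W_def U'_def W'_def by algebra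
  then show ?thesis by simp
qed

lemma sum_squares_frame: "2 * min (k\<^sub>1\<^sup>2) (k\<^sub>2\<^sup>2) \<le> (U \<theta>)\<^sup>2 + (W \<theta>)\<^sup>2"
proof -
  have "2 * min (k\<^sub>1\<^sup>2) (k\<^sub>2\<^sup>2) = 2 * (min (k\<^sub>1\<^sup>2) (k\<^sub>2\<^sup>2) * (sin \<theta>)\<^sup>2 + min (k\<^sub>1\<^sup>2) (k\<^sub>2\<^sup>2) * (cos \<theta>)\<^sup>2)"
    by (simp flip: distrib_left)
  also have "\<dots> \<le> 2 * (k\<^sub>1\<^sup>2 * (sin \<theta>)\<^sup>2 + k\<^sub>2\<^sup>2 * (cos \<theta>)\<^sup>2)"
    by (intro mult_left_mono add_mono mult_right_mono) auto
  also have "\<dots> = (U \<theta>)\<^sup>2 + (W \<theta>)\<^sup>2" unfolding U_def W_def by algebra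
  finally show ?thesis .
qed

text \<open>Apart from half its trace, the coupling matrix is [a, -n; n, -a] with a = (2 n - 1 -
  \<alpha>) / 2, which preserves n u^2 - 2 a u v + n v^2. In the half sum and half difference of u
  and v this form is diagonal with weights \<open>k\<^sub>2\<^sup>2\<close> and
  \<open>k\<^sub>1\<^sup>2\<close>, so the frame runs along one of its ellipses. Only half the trace
  contributes to the radial speed, independently of \<theta>.\<close>

lemma linear_growth:
  "d * (W' \<theta> * ((n - 1) * (g * U \<theta>) - n * (g * W \<theta>)) - U' \<theta> * (n * (g * U \<theta>) - (n - \<alpha>) * (g * W \<theta>)))
    = c * g * (\<alpha> - 1) / 2"
proof -
  define s t where "s = sin \<theta>" and "t = cos \<theta>"
  have st: "s\<^sup>2 + t\<^sup>2 = 1" by (simp add: s_def t_def)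
  have "W' \<theta> * ((n - 1) * U \<theta> - n * W \<theta>) - U' \<theta> * (n * U \<theta> - (n - \<alpha>) * W \<theta>) = k\<^sub>1 * k\<^sub>2 * (\<alpha> - 1)"
    unfolding U_def W_def U'_def W'_def s_def[symmetric] t_def[symmetric]
    using k_squares st by algebra
  then have "d * (W' \<theta> * ((n - 1) * (g * U \<theta>) - n * (g * W \<theta>)) - U' \<theta> * (n * (g * U \<theta>) - (n - \<alpha>) * (g * W \<theta>)))
      = d * g * (k\<^sub>1 * k\<^sub>2 * (\<alpha> - 1))" by algebra
  then show ?thesis using k_pos by (simp add: d_def field_simps)
qed

text \<open>Used twice: with e the linearisation error near the origin, and with e =
  \<open>exp (- \<rho>)\<close> in the saturated regime.\<close>

lemma radial_bound:
  assumes "\<bar>s\<bar> \<le> e" "\<bar>t\<bar> \<le> e"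
  shows "\<bar>d * (W' \<theta> * ((n - 1) * s - n * t) - U' \<theta> * (n * s - (n - \<alpha>) * t))\<bar> \<le> d * (4 * n * (k\<^sub>1 + k\<^sub>2)) * e"
proof -
  have e: "0 \<le> e" using assms by linarith
  have 1: "\<bar>a * s\<bar> \<le> n * e" "\<bar>a * t\<bar> \<le> n * e" if "0 \<le> a" "a \<le> n" for a
    unfolding abs_mult using assms that by (intro mult_mono; simp)+
  have 2: "\<bar>(n - 1) * s - n * t\<bar> \<le> 2 * n * e" "\<bar>n * s - (n - \<alpha>) * t\<bar> \<le> 2 * n * e"
    using 1(1)[of "n - 1"] 1(2)[of n] 1(1)[of n] 1(2)[of "n - \<alpha>"] \<alpha> n by linarith+
  have "\<bar>W' \<theta> * ((n - 1) * s - n * t)\<bar> \<le> (k\<^sub>1 + k\<^sub>2) * (2 * n * e)"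
    "\<bar>U' \<theta> * (n * s - (n - \<alpha>) * t)\<bar> \<le> (k\<^sub>1 + k\<^sub>2) * (2 * n * e)"
    unfolding abs_mult[of "W' \<theta>"] abs_mult[of "U' \<theta>"]
    using k_pos 2 frame_bounds by (intro mult_mono; simp)+
  then have "\<bar>W' \<theta> * ((n - 1) * s - n * t) - U' \<theta> * (n * s - (n - \<alpha>) * t)\<bar> \<le> 4 * n * (k\<^sub>1 + k\<^sub>2) * e"
    by (simp add: algebra_simps)
  then show ?thesis
    unfolding abs_mult[of d] using d_pos by (simp add: mult.assoc)
qed

text \<open>The radial speed is \<kappa>, half the trace, plus an error of at most Z exp \<rho>; the
  threshold makes this error at most \<kappa> / 2.\<close>

lemma p_low: "\<exists>m. \<forall>\<rho>\<le>m. \<forall>\<theta>. 0 < p \<rho> \<theta>"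
proof -
  define \<kappa> where "\<kappa> = c * g * (\<alpha> - 1) / 2 - 1"
  define Z where "Z = d * (4 * n * (k\<^sub>1 + k\<^sub>2)) * (g\<^sup>2 * (k\<^sub>1 + k\<^sub>2)\<^sup>2)"
  have \<kappa>: "\<kappa> > 0" using unstable by (simp add: \<kappa>_def)
  have Z: "Z > 0" unfolding Z_def using d_pos k_pos g \<alpha> n by (intro mult_pos_pos) auto
  have "0 < p \<rho> \<theta>" if \<rho>: "\<rho> \<le> ln (\<kappa> / (2 * Z))" for \<rho> \<theta>
  proof -
    have err: "\<bar>exp (- \<rho>) * tanh (g * (exp \<rho> * x)) - g * x\<bar> \<le> exp \<rho> * (g\<^sup>2 * (k\<^sub>1 + k\<^sub>2)\<^sup>2)"
      if "\<bar>x\<bar> \<le> k\<^sub>1 + k\<^sub>2" for x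
    proof -
      have "exp (- \<rho>) * tanh (g * (exp \<rho> * x)) - g * x = exp (- \<rho>) * (tanh (g * (exp \<rho> * x)) - g * (exp \<rho> * x))"
        by (simp add: exp_minus field_simps)
      also have "\<bar>\<dots>\<bar> \<le> exp (- \<rho>) * (g * (exp \<rho> * x))\<^sup>2"
        unfolding abs_mult[of "exp _"] using abs_tanh_diff_self_le by (intro mult_mono) auto
      also have "\<dots> = exp \<rho> * (g\<^sup>2 * x\<^sup>2)" by (simp add: exp_minus power2_eq_square field_simps)
      also have "\<dots> \<le> exp \<rho> * (g\<^sup>2 * (k\<^sub>1 + k\<^sub>2)\<^sup>2)"
        using power_mono[OF that, of 2] by (intro mult_left_mono) auto
      finally show ?thesis .
    qed
    define s t where "s = \<sigma> \<rho> \<theta> - g * U \<theta>" and "t = \<tau> \<rho> \<theta> - g * W \<theta>"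
    have "\<bar>s\<bar> \<le> exp \<rho> * (g\<^sup>2 * (k\<^sub>1 + k\<^sub>2)\<^sup>2)" "\<bar>t\<bar> \<le> exp \<rho> * (g\<^sup>2 * (k\<^sub>1 + k\<^sub>2)\<^sup>2)"
      using err frame_bounds by (simp_all add: s_def t_def \<sigma>_def \<tau>_def)
    from radial_bound[OF this, of \<theta>]
    have "\<bar>d * (W' \<theta> * ((n - 1) * s - n * t) - U' \<theta> * (n * s - (n - \<alpha>) * t))\<bar> \<le> Z * exp \<rho>"
      by (simp add: Z_def mult_ac)
    moreover have "p \<rho> \<theta> = \<kappa> + d * (W' \<theta> * ((n - 1) * s - n * t) - U' \<theta> * (n * s - (n - \<alpha>) * t))"
    proof -
      have split: "d * (w * ((n - 1) * a - n * b) - z * (n * a - (n - \<alpha>) * b)) =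
        d * (w * ((n - 1) * a' - n * b') - z * (n * a' - (n - \<alpha>) * b')) +
        d * (w * ((n - 1) * (a - a') - n * (b - b')) - z * (n * (a - a') - (n - \<alpha>) * (b - b')))"
        for w z a a' b b' by algebra
      show ?thesis
        unfolding p_def s_def t_def \<kappa>_def
          split[of "W' \<theta>" "\<sigma> \<rho> \<theta>" "\<tau> \<rho> \<theta>" "U' \<theta>" "g * U \<theta>" "g * W \<theta>"] linear_growth by simp
    qed
    moreover have "Z * exp \<rho> \<le> \<kappa> / 2"
    proof -
      have "exp \<rho> \<le> \<kappa> / (2 * Z)" using \<rho> \<kappa> Z by (simp add: ln_ge_iff)
      then show ?thesis using Z by (simp add: field_simps)
    qed
    ultimately show ?thesis using \<kappa> by linarith
  qed
  then show ?thesis by blast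
qed

text \<open>As \<open>tanh\<close> is bounded, the coupling contributes at most Z exp (-\<rho>), and
  the leak -1 wins.\<close>

lemma p_high: "\<exists>M. \<forall>\<rho>\<ge>M. \<forall>\<theta>. p \<rho> \<theta> < 0"
proof -
  define Z where "Z = d * (4 * n * (k\<^sub>1 + k\<^sub>2))"
  have Z: "Z > 0" unfolding Z_def using d_pos k_pos \<alpha> n by (intro mult_pos_pos) auto
  have "p \<rho> \<theta> < 0" if \<rho>: "ln (2 * Z) \<le> \<rho>" for \<rho> \<theta>
  proof -
    have "\<bar>exp (- \<rho>) * tanh x\<bar> \<le> exp (- \<rho>)" for x
      using tanh_real_bounds[of x] by (simp add: abs_mult abs_le_iff)
    then have "\<bar>\<sigma> \<rho> \<theta>\<bar> \<le> exp (- \<rho>)" "\<bar>\<tau> \<rho> \<theta>\<bar> \<le> exp (- \<rho>)" unfolding \<sigma>_def \<tau>_def by blast+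
    from radial_bound[OF this, of \<theta>] have "p \<rho> \<theta> \<le> - 1 + Z * exp (- \<rho>)"
      unfolding p_def Z_def by linarith
    moreover have "2 * Z \<le> exp \<rho>" using \<rho> Z by (metis exp_le_cancel_iff exp_ln mult_pos_pos zero_less_numeral)
    then have "Z * exp (- \<rho>) \<le> 1 / 2" by (simp add: exp_minus field_simps)
    ultimately show ?thesis by linarith
  qed
  then show ?thesis by blast
qed

text \<open>On \<rho> <= M the arguments of \<open>tanh\<close> are at most E - 1, so s tanh s >=
  s^2 / E there; the frame stays away from 0, which makes the sum of both terms uniformly positive.
  The bound depends on M, as q decays far out.\<close>

lemma q_ge: "\<exists>\<delta>>0. \<forall>\<rho>\<le>M. \<forall>\<theta>. \<delta> \<le> q \<rho> \<theta>"
proof -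
  define E where "E = 1 + g * (exp M * (k\<^sub>1 + k\<^sub>2))"
  have E: "E > 0" unfolding E_def using g k_pos by (intro add_pos_pos mult_pos_pos) auto
  define \<delta> where "\<delta> = d * (g * (2 * min (k\<^sub>1\<^sup>2) (k\<^sub>2\<^sup>2)) / E)"
  have "\<delta> > 0" unfolding \<delta>_def using d_pos g k_pos E by simp
  moreover have "\<delta> \<le> q \<rho> \<theta>" if \<rho>: "\<rho> \<le> M" for \<rho> \<theta>
  proof -
    have lb: "g * x\<^sup>2 / E \<le> x * (exp (- \<rho>) * tanh (g * (exp \<rho> * x)))" if "\<bar>x\<bar> \<le> k\<^sub>1 + k\<^sub>2" for x
    proof -
      define y where "y = g * (exp \<rho> * x)"
      have gx: "exp (- \<rho>) * y = g * x" by (simp add: y_def exp_minus)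
      have "\<bar>y\<bar> \<le> g * (exp M * (k\<^sub>1 + k\<^sub>2))"
        unfolding y_def abs_mult using g that \<rho> by (intro mult_mono) auto
      then have "y\<^sup>2 / E \<le> y\<^sup>2 / (1 + \<bar>y\<bar>)" unfolding E_def by (intro divide_left_mono) auto
      then have "y\<^sup>2 / E \<le> y * tanh y" using tanh_mult_self_ge[of y] by linarith
      then have "exp (- \<rho>) * (exp (- \<rho>) * (y\<^sup>2 / E)) \<le> exp (- \<rho>) * (exp (- \<rho>) * (y * tanh y))"
        by (intro mult_left_mono) auto
      moreover have "exp (- \<rho>) * (exp (- \<rho>) * (y\<^sup>2 / E)) = g * (g * x\<^sup>2 / E)"
      proof -
        have "exp (- \<rho>) * (exp (- \<rho>) * (y\<^sup>2 / E)) = (exp (- \<rho>) * y)\<^sup>2 / E"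
          by (simp add: power2_eq_square)
        also have "\<dots> = g * (g * x\<^sup>2 / E)" unfolding gx by (simp add: power2_eq_square)
        finally show ?thesis .
      qed
      moreover have "exp (- \<rho>) * (exp (- \<rho>) * (y * tanh y)) = g * (x * (exp (- \<rho>) * tanh y))"
        using gx by (metis mult.assoc mult.commute)
      ultimately have "g * (g * x\<^sup>2 / E) \<le> g * (x * (exp (- \<rho>) * tanh y))" by linarith
      then show ?thesis using g unfolding y_def by (rule mult_left_le_imp_le)
    qed
    have "g * (2 * min (k\<^sub>1\<^sup>2) (k\<^sub>2\<^sup>2)) / E \<le> g * ((U \<theta>)\<^sup>2 + (W \<theta>)\<^sup>2) / E"
      using g E sum_squares_frame by (intro divide_right_mono mult_left_mono) auto
    also have "\<dots> \<le> U \<theta> * \<sigma> \<rho> \<theta> + W \<theta> * \<tau> \<rho> \<theta>"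
      using lb[OF frame_bounds(1)] lb[OF frame_bounds(2)]
      by (simp add: \<sigma>_def \<tau>_def distrib_left add_divide_distrib add_mono)
    also have "\<dots> \<le> U \<theta> * (n * \<sigma> \<rho> \<theta> - (n - \<alpha>) * \<tau> \<rho> \<theta>) - W \<theta> * ((n - 1) * \<sigma> \<rho> \<theta> - n * \<tau> \<rho> \<theta>)"
    proof -
      \<comment> \<open>The rotation inequality is applied to the frame itself, with gain
        \<open>g * exp \<rho>\<close> in place of g.\<close>
      have "0 < g * exp \<rho>" using g by simp
      from rotation_form_ge[OF \<alpha> n this, of "U \<theta>" "W \<theta>"]
      have "exp (- \<rho>) * (U \<theta> * tanh (g * exp \<rho> * U \<theta>) + W \<theta> * tanh (g * exp \<rho> * W \<theta>)) \<le>
        exp (- \<rho>) * (U \<theta> * (n * tanh (g * exp \<rho> * U \<theta>) - (n - \<alpha>) * tanh (g * exp \<rho> * W \<theta>))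
          - W \<theta> * ((n - 1) * tanh (g * exp \<rho> * U \<theta>) - n * tanh (g * exp \<rho> * W \<theta>)))"
        by (intro mult_left_mono) auto
      then show ?thesis by (simp add: \<sigma>_def \<tau>_def algebra_simps)
    qed
    finally show ?thesis unfolding \<delta>_def q_def using d_pos by (intro mult_left_mono) auto
  qed
  ultimately show ?thesis by blast
qed

lemma coefficients:
  "lipschitz_coefficient (2 * pi) p" "lipschitz_coefficient (2 * pi) q"
proof -
  have cont: "continuous_on UNIV U" "continuous_on UNIV W" "continuous_on UNIV U'" "continuous_on UNIV W'"
    unfolding U_def W_def U'_def W'_def by (intro continuous_intros)+
  have per: "U (\<theta> + 2 * pi) = U \<theta>" "W (\<theta> + 2 * pi) = W \<theta>"
    "U' (\<theta> + 2 * pi) = U' \<theta>" "W' (\<theta> + 2 * pi) = W' \<theta>" for \<theta>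
    unfolding U_def W_def U'_def W'_def by simp_all
  have \<sigma>\<tau>: "lipschitz_coefficient (2 * pi) \<sigma>" "lipschitz_coefficient (2 * pi) \<tau>"
    unfolding \<sigma>_def \<tau>_def
    by (rule lipschitz_coefficient_tanh[OF cont(1) frame_bounds(1) per(1)]
        lipschitz_coefficient_tanh[OF cont(2) frame_bounds(2) per(2)])+
  note frame = lipschitz_coefficient_time_only[OF cont(1) frame_bounds(1) per(1)]
    lipschitz_coefficient_time_only[OF cont(2) frame_bounds(2) per(2)]
    lipschitz_coefficient_time_only[OF cont(3) frame_bounds(3) per(3)]
    lipschitz_coefficient_time_only[OF cont(4) frame_bounds(4) per(4)]
  \<comment> \<open>Differences are rewritten as sums with negative constants, so that the closure
    rules for sums, products and constants apply.\<close>
  have p: "p = (\<lambda>\<rho> \<theta>. - 1 + d * (W' \<theta> * ((n - 1) * \<sigma> \<rho> \<theta> + - n * \<tau> \<rho> \<theta>) +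
      (- 1) * (U' \<theta> * (n * \<sigma> \<rho> \<theta> + - (n - \<alpha>) * \<tau> \<rho> \<theta>))))"
    and q: "q = (\<lambda>\<rho> \<theta>. d * (U \<theta> * (n * \<sigma> \<rho> \<theta> + - (n - \<alpha>) * \<tau> \<rho> \<theta>) +
      (- 1) * (W \<theta> * ((n - 1) * \<sigma> \<rho> \<theta> + - n * \<tau> \<rho> \<theta>))))"
    by (simp_all add: fun_eq_iff p_def q_def algebra_simps)
  show "lipschitz_coefficient (2 * pi) p" "lipschitz_coefficient (2 * pi) q"
    unfolding p q
    by (intro lipschitz_coefficient_add lipschitz_coefficient_mult lipschitz_coefficient_const frame \<sigma>\<tau>)+
qed

text \<open>Cramer's rule: p and q are the components, in the frame (U, W), (U', W'), of the field
  divided by the radius \<open>exp \<rho>\<close>.\<close>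

lemma polar_velocity:
  "p \<rho> \<theta> * U \<theta> + q \<rho> \<theta> * U' \<theta> = - U \<theta> + c * ((n - 1) * \<sigma> \<rho> \<theta> - n * \<tau> \<rho> \<theta>)"
  "p \<rho> \<theta> * W \<theta> + q \<rho> \<theta> * W' \<theta> = - W \<theta> + c * (n * \<sigma> \<rho> \<theta> - (n - \<alpha>) * \<tau> \<rho> \<theta>)"
proof -
  have dw: "d * (U \<theta> * W' \<theta> - W \<theta> * U' \<theta>) = c"
    unfolding wronskian using k_pos by (simp add: d_def)
  have comb: "(- 1 + d * (w' * a - u' * b)) * u + d * (u * b - w * a) * u' = - u + d * (u * w' - w * u') * a"
    "(- 1 + d * (w' * a - u' * b)) * w + d * (u * b - w * a) * w' = - w + d * (u * w' - w * u') * b"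
    for a b u w u' w' by (simp_all add: algebra_simps)
  show "p \<rho> \<theta> * U \<theta> + q \<rho> \<theta> * U' \<theta> = - U \<theta> + c * ((n - 1) * \<sigma> \<rho> \<theta> - n * \<tau> \<rho> \<theta>)"
    "p \<rho> \<theta> * W \<theta> + q \<rho> \<theta> * W' \<theta> = - W \<theta> + c * (n * \<sigma> \<rho> \<theta> - (n - \<alpha>) * \<tau> \<rho> \<theta>)"
    unfolding p_def q_def comb dw by (rule refl)+
qed

text \<open>Sum and difference of the two coordinates isolate the sine and the cosine; their squares
  then determine the radius.\<close>

lemma frame_inj:
  assumes "exp \<rho> * U \<theta> = exp \<rho>' * U \<theta>'" "exp \<rho> * W \<theta> = exp \<rho>' * W \<theta>'"
  shows "\<rho> = \<rho>' \<and> (\<exists>k::int. \<theta> = \<theta>' + of_int k * (2 * pi))"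
proof -
  have "k\<^sub>1 * (exp \<rho> * sin \<theta>) = k\<^sub>1 * (exp \<rho>' * sin \<theta>')" "k\<^sub>2 * (exp \<rho> * cos \<theta>) = k\<^sub>2 * (exp \<rho>' * cos \<theta>')"
  proof -
    have "exp \<rho> * (k\<^sub>1 * sin \<theta>) = exp \<rho>' * (k\<^sub>1 * sin \<theta>')" "exp \<rho> * (k\<^sub>2 * cos \<theta>) = exp \<rho>' * (k\<^sub>2 * cos \<theta>')"
      using assms unfolding U_def W_def distrib_left right_diff_distrib by linarith+
    then show "k\<^sub>1 * (exp \<rho> * sin \<theta>) = k\<^sub>1 * (exp \<rho>' * sin \<theta>')" "k\<^sub>2 * (exp \<rho> * cos \<theta>) = k\<^sub>2 * (exp \<rho>' * cos \<theta>')"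
      by (simp_all only: mult.left_commute)
  qed
  then have sc: "exp \<rho> * sin \<theta> = exp \<rho>' * sin \<theta>'" "exp \<rho> * cos \<theta> = exp \<rho>' * cos \<theta>'"
    using k_pos by simp_all
  have sq: "(exp r)\<^sup>2 = (exp r * sin t)\<^sup>2 + (exp r * cos t)\<^sup>2" for r t :: real
    by (simp add: power_mult_distrib flip: distrib_left)
  have "(exp \<rho>)\<^sup>2 = (exp \<rho>')\<^sup>2" using sq[of \<rho> \<theta>] sq[of \<rho>' \<theta>'] unfolding sc by simp
  then have "\<rho> = \<rho>'" by (simp add: power2_eq_iff_nonneg)
  then have "sin \<theta> = sin \<theta>' \<and> cos \<theta> = cos \<theta>'" using sc by simp
  then obtain k :: int where "\<theta> = \<theta>' + 2 * pi * of_int k" unfolding sin_cos_eq_iff by blast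
  with \<open>\<rho> = \<rho>'\<close> show ?thesis by (auto simp: mult.commute)
qed

lemma frame_derivs:
  "(U has_real_derivative U' \<theta>) (at \<theta>)" "(W has_real_derivative W' \<theta>) (at \<theta>)"
  unfolding U_def[abs_def] W_def[abs_def] U'_def W'_def by (auto intro!: derivative_eq_intros)

text \<open>F is prescribed only on the plane of two-level states: both the cycle and the orbit
  approaching it are built inside this invariant plane.\<close>

lemma synchronous_limit_cycle:
  fixes F :: "real^('e::finite + 'i::finite) \<Rightarrow> real^('e + 'i)"
  assumes F: "\<And>u v. F (two_level u v) =
    two_level (- u + c * ((n - 1) * tanh (g * u) - n * tanh (g * v)))
      (- v + c * (n * tanh (g * u) - (n - \<alpha>) * tanh (g * v)))"
  shows "\<exists>x. is_limit_cycle F x \<and> (\<forall>t. \<exists>u v. x t = two_level u v)"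
proof -
  define C where "C = (\<lambda>\<rho> \<theta>. two_level (exp \<rho> * U \<theta>) (exp \<rho> * W \<theta>) :: real^('e + 'i))"
  obtain m where m: "\<And>\<rho> \<theta>. \<rho> \<le> m \<Longrightarrow> 0 < p \<rho> \<theta>" using p_low by blast
  obtain M\<^sub>0 where M\<^sub>0: "\<And>\<rho> \<theta>. M\<^sub>0 \<le> \<rho> \<Longrightarrow> p \<rho> \<theta> < 0" using p_high by blast
  \<comment> \<open>The maximum secures m < M; \<delta> is chosen afterwards because it depends on
    M.\<close>
  define M where "M = max M\<^sub>0 (m + 1)"
  obtain \<delta> where \<delta>: "\<delta> > 0" "\<And>\<rho> \<theta>. \<rho> \<le> M \<Longrightarrow> \<delta> \<le> q \<rho> \<theta>" using q_ge[of M] by blast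
  have "\<exists>x. is_limit_cycle F x \<and> (\<forall>t. \<exists>\<rho> \<theta>. x t = C \<rho> \<theta>)"
  proof (rule limit_cycle_polar[OF _ coefficients \<delta> m])
    show "m < M" "p M \<theta> < 0" for \<theta> using M\<^sub>0[of M] by (auto simp: M_def)
    have "continuous_on UNIV (\<lambda>x. two_level (exp (fst x) * U (snd x)) (exp (fst x) * W (snd x)) :: real^('e + 'i))"
      unfolding two_level_linear[of "_ * _"] U_def W_def by (intro continuous_intros)
    then show "continuous_on UNIV (\<lambda>(\<rho>, \<theta>). C \<rho> \<theta>)" by (simp add: C_def case_prod_beta)
    show "C \<rho> (\<theta> + 2 * pi) = C \<rho> \<theta>" for \<rho> \<theta> by (simp add: C_def U_def W_def)
    show "\<rho> = \<rho>' \<and> (\<exists>k::int. \<theta> = \<theta>' + of_int k * (2 * pi))" if "C \<rho> \<theta> = C \<rho>' \<theta>'" for \<rho> \<theta> \<rho>' \<theta>'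
      using that by (intro frame_inj) (auto simp: C_def two_level_eq_iff)
    show "((\<lambda>t. C (\<rho> t) (\<theta> t)) has_vector_derivative F (C (\<rho> t) (\<theta> t))) (at t)"
      if \<rho>: "(\<rho> has_real_derivative p (\<rho> t) (\<theta> t)) (at t)" and \<theta>: "(\<theta> has_real_derivative q (\<rho> t) (\<theta> t)) (at t)"
      for \<rho> \<theta> t
    proof -
      let ?r = "\<rho> t" and ?t = "\<theta> t"
      have tanh: "tanh (g * (exp ?r * U ?t)) = exp ?r * \<sigma> ?r ?t" "tanh (g * (exp ?r * W ?t)) = exp ?r * \<tau> ?r ?t"
        by (simp_all add: \<sigma>_def \<tau>_def exp_minus)
      have "((\<lambda>t. exp (\<rho> t) * U (\<theta> t)) has_real_derivative exp ?r * (p ?r ?t * U ?t + q ?r ?t * U' ?t)) (at t)"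
        "((\<lambda>t. exp (\<rho> t) * W (\<theta> t)) has_real_derivative exp ?r * (p ?r ?t * W ?t + q ?r ?t * W' ?t)) (at t)"
        by (auto intro!: derivative_eq_intros \<rho> DERIV_chain2[OF frame_derivs(1) \<theta>] DERIV_chain2[OF frame_derivs(2) \<theta>]
            simp: algebra_simps)
      then have "((\<lambda>t. C (\<rho> t) (\<theta> t)) has_vector_derivative
          two_level (exp ?r * (p ?r ?t * U ?t + q ?r ?t * U' ?t)) (exp ?r * (p ?r ?t * W ?t + q ?r ?t * W' ?t))) (at t)"
        unfolding C_def by (rule two_level_has_vector_derivative)
      moreover have "F (C ?r ?t) =
          two_level (exp ?r * (p ?r ?t * U ?t + q ?r ?t * U' ?t)) (exp ?r * (p ?r ?t * W ?t + q ?r ?t * W' ?t))"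
        unfolding C_def F tanh polar_velocity by (simp add: two_level_eq_iff algebra_simps)
      ultimately show ?thesis by simp
    qed
  qed auto
  then show ?thesis unfolding C_def by blast
qed

end

theorem proposition5p2:
  fixes nE nI N :: nat and f \<alpha> \<mu> g :: real
  assumes "nE = CARD('e::finite)" and "nI = CARD('i::finite)"
    and "N = nE + nI"
    and "f = real nE / real N" and "\<alpha> = f / (1 - f)"
    and "\<alpha> > 1" and "\<mu> > 0"
    and "g > 2 * sqrt (real N) / ((\<alpha> - 1) * \<mu>)"
  shows "\<exists>x :: real \<Rightarrow> real^('e + 'i).
    is_limit_cycle (network_field \<alpha> \<mu> g) x \<and>
    (\<forall>t a b. x t $ Inl a = x t $ Inl b) \<and>
    (\<forall>t a b. x t $ Inr a = x t $ Inr b)"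
proof -
  have nI: "nI \<ge> 1" using assms(2) by (simp add: Suc_leI)
  have N: "real N > 0" using nI assms(3) by simp
  have balance: "real nE = \<alpha> * real nI"
  proof -
    have "1 - f = real nI / real N" using N assms(3,4) by (simp add: field_simps)
    then show ?thesis using nI N assms(4,5) by simp
  qed
  have cardN: "CARD('e + 'i) = N" using assms(1-3) by simp
  define c where "c = \<mu> / sqrt (real N)"
  have c: "c > 0" using \<open>\<mu> > 0\<close> N by (simp add: c_def)
  \<comment> \<open>The threshold g_H in terms of c; clearing the denominator gives the positive
    trace, which in turn forces g > 0.\<close>
  have "2 / (c * (\<alpha> - 1)) < g"
    using assms(8) by (simp add: c_def mult.commute)
  then have unst: "2 < c * g * (\<alpha> - 1)"
    using c \<open>\<alpha> > 1\<close> by (simp add: pos_divide_less_eq mult_ac)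
  moreover have "g > 0"
    using unst c \<open>\<alpha> > 1\<close> by (smt (verit) mult_nonneg_nonneg mult_nonneg_nonpos2 mult_nonneg_nonpos)
  moreover have "\<alpha> \<le> real nE"
    unfolding balance using \<open>\<alpha> > 1\<close> nI by simp
  ultimately interpret synchronous_network "real nE" \<alpha> c g
    using c \<open>\<alpha> > 1\<close> by unfold_locales
  have "network_field \<alpha> \<mu> g (two_level u v :: real^('e + 'i)) =
      two_level (- u + c * ((real nE - 1) * tanh (g * u) - real nE * tanh (g * v)))
        (- v + c * (real nE * tanh (g * u) - (real nE - \<alpha>) * tanh (g * v)))" for u v
    using network_field_two_level[OF balance[unfolded assms(1,2)], of \<mu> g u v]
    unfolding cardN c_def assms(1) .
  from synchronous_limit_cycle[OF this] obtain x :: "real \<Rightarrow> real^('e + 'i)"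
    where x: "is_limit_cycle (network_field \<alpha> \<mu> g) x" "\<And>t. \<exists>u v. x t = two_level u v"
    by blast
  have "x t $ Inl a = x t $ Inl b" "x t $ Inr a' = x t $ Inr b'" for t a b a' b'
    using x(2)[of t] by auto
  with x(1) show ?thesis by blast
qed

end
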